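(* Let $\sigma:X\to Y$ be a strong formal subdivision between lower Eulerian posets with associated poset $\Gamma$, consider an Eulerian action of a finite group $W$ on $\Gamma$ fixing $\hat0_Y$ and preserving $\rho_\Gamma$, fix a $W$-invariant weak rank function $r_\Gamma$ and a multiplicative and rank alternating $\kappa_\Gamma\in\mathcal{I}^W(\Gamma)\cap U^W(\Gamma)$ (as in the context). Then \[ g_\Gamma|_{X/Y}=\Delta\ell_\sigma\cdot g_\Gamma=\Delta\ell_\sigma\cdot g_\Gamma|_Y,\] \[ f_\Gamma|_{X/Y}=-f_\Gamma\cdot\Delta\widehat{\ell_\sigma}=-f_\Gamma|_X\cdot\Delta\widehat{\ell_\sigma},\] \[ Z_\Gamma|_{X/Y}=-Z_\Gamma|_X\cdot\Delta\widehat{\ell_\sigma}+(\Delta\ell_\sigma)^{\mathrm{rev}}\cdot Z_\Gamma|_Y.\] In particular, for $x\in X$, $y\in Y$ with $\sigma(x)\le y$, $g_\Gamma(x,y)=\sum_{\sigma(x)\le y'\le y}\frac{|W_{x,y',y}|}{|W_{x,y}|}\mathrm{Ind}^{W_{x,y}}_{W_{x,y',y}}\big(\mathrm{Res}^{W_{x,y'}}_{W_{x,y',y}}\Delta\ell_\sigma(x,y')\cdot\mathrm{Res}^{W_{y',y}}_{W_{x,y',y}}g_Y(y',y)\big)$.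
   Context: A finite poset is lower Eulerian if it has a unique minimal element, a rank function $\rho$ ($\rho(z')=\rho(z)+1$ when $z'$ covers $z$), and $\sum_{z\le z''\le z'}(-1)^{\rho(z'')}=0$ for $z<z'$. $X,Y$ lower Eulerian with rank functions $\rho_X,\rho_Y$; $\sigma:X\to Y$ a strong formal subdivision: order-preserving; $\rho_X(x)\le\rho_Y(\sigma(x))$; surjective, and for $x\in X,y\in Y$ with $\sigma(x)\le y$ there is $x'\ge x$ with $\rho_X(x')=\rho_Y(y)$, $\sigma(x')=y$; and $\sum_{x\le x'\in X,\sigma(x')=y}(-1)^{\rho_Y(y)-\rho_X(x')}=1$. $\Gamma$ is the poset on $X\sqcup Y$ with the orders of $X,Y$ and $x\le y$ iff $\sigma(x)\le y$ ($x\in X,y\in Y$); it is lower Eulerian with rank function $\rho_\Gamma=\rho_X$ on $X$, $\rho_Y+1$ on $Y$. $W$ acts on $\Gamma$ by order-preserving bijections preserving $\rho_\Gamma$ and fixing $\hat0_Y$; the action is Eulerian: each $\Gamma^w=\{z:wz=z\}$ is lower Eulerian (rank difference $\rho_{\Gamma^w}$). Representations complex; $R(G)$ representation ring; $\mathrm{Res},\mathrm{Ind}$ coefficientwise; $\mathrm{ev}_w$ evaluates characters at $w$. $W_z$ stabilizer, $W_{z,z'}=W_z\cap W_{z'}$, $W_{z,z'',z'}$ triple intersection. $I^W(\Gamma)$: functions $p$ on intervals with $p(z,z')\in R(W_{z,z'})[t]$, compatible with conjugation (pullback along $u\mapsto wuw^{-1}$); product $(p\cdot p')(z,z')=\sum_{z\le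 z''\le z'}\frac{|W_{z,z'',z'}|}{|W_{z,z'}|}\mathrm{Ind}^{W_{z,z'}}_{W_{z,z'',z'}}(\mathrm{Res}^{W_{z,z''}}_{W_{z,z'',z'}}p(z,z'')\cdot\mathrm{Res}^{W_{z'',z'}}_{W_{z,z'',z'}}p'(z'',z'))$. $r_\Gamma$: $W$-invariant weak rank function (nonnegative integers, positive for $z<z'$, additive). $\mathcal{I}^W(\Gamma)=\{p:\deg p(z,z')\le r_\Gamma(z,z')\}$, $p^{\mathrm{rev}}(z,z';t)=t^{r_\Gamma(z,z')}p(z,z';t^{-1})$; $\mathcal{I}^W_{1/2}$ adds $\deg p(z,z')<r_\Gamma(z,z')/2$ for $z<z'$; $U^W=\{p:p(z,z)=1\}$. $\widehat p$ is determined by $\mathrm{ev}_w(\widehat p)(z,z')=(-1)^{\rho_{\Gamma^w}(z,z')}\mathrm{ev}_w(p(z,z'))$ for all $w$, $z\le z'$ in $\Gamma^w$. Rank alternating: $p^{\mathrm{rev}}=\widehat p$; multiplicative: $\mathrm{ev}_w(p(z,z'))=\mathrm{ev}_w(p(z,z''))\mathrm{ev}_w(p(z'',z'))$ for all $w$, $z\le z''\le z'$ in $\Gamma^w$. Then $\kappa_\Gamma$ is an equivariant kernel ($\kappa_\Gamma^{-1}=\kappa_\Gamma^{\mathrm{rev}}$); $f_\Gamma,g_\Gamma$ are the unique elements of $\mathcal{I}^W_{1/2}(\Gamma)\cap U^W(\Gamma)$ with $f_\Gamma^{\mathrm{rev}}=\kappa_\Gamma\cdot f_\Gamma$, $g_\Gamma^{\mathrm{rev}}=g_\Gamma\cdot\kappa_\Gamma$,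 and $Z_\Gamma=g_\Gamma\cdot\kappa_\Gamma\cdot f_\Gamma$; $g_Y$ is the restriction of $g_\Gamma$ to intervals in $Y$. For $p\in\mathcal{I}^W(\Gamma)$, $p|_X,p|_Y,p|_{X/Y},p|_{(X/Y)^\circ}$ agree with $p$ on intervals $[z,z']$ with $z,z'\in X$; $z,z'\in Y$; $z\in X,z'\in Y$; $z\in X, z'=\sigma(z)$ respectively, and are $0$ elsewhere. $\Delta p$: $(\Delta p)(z,z)=0$ and for $z<z'$ with $p(z,z')=\sum_ia_it^i$ ($a_i\in R(W_{z,z'})$), $(\Delta p)(z,z')=a_0+\sum_{i=1}^{\lfloor(r_\Gamma(z,z')-1)/2\rfloor}(a_i-a_{i-1})t^i$. Equivariant $h$- and local $h$-polynomials $h_\sigma,\ell_\sigma\in\mathcal{I}^W(\Gamma)$: $(t-1)\cdot h_\sigma=g_\Gamma\cdot\kappa_\Gamma|_{(X/Y)^\circ}$, $\ell_\sigma=h_\sigma\cdot g_\Gamma^{-1}$. *)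

theory Defs
  imports
    "HOL-Library.Function_Algebras"
    "HOL-Library.Indicator_Function"
    "HOL-Computational_Algebra.Polynomial"
    "HOL-Algebra.Group_Action"
    "Jordan_Normal_Form.Matrix"
begin

section \<open>Lower Eulerian posets\<close>

text \<open>A poset is a carrier set \<open>P\<close> with an order relation \<open>r\<close> satisfying
  \<^term>\<open>partial_order_on P r\<close>. Rank functions are integer valued and not normalised at the minimum;
  off \<open>P\<close> their values are irrelevant.\<close>

definition covers :: "'z rel \<Rightarrow> 'z \<Rightarrow> 'z \<Rightarrow> bool" where
  "covers r z z' \<longleftrightarrow> (z, z') \<in> r \<and> z \<noteq> z' \<and>
     (\<forall>u. (z, u) \<in> r \<and> (u, z') \<in> r \<longrightarrow> u = z \<or> u = z')"

definition rank_function :: "'z rel \<Rightarrow> ('z \<Rightarrow> int) \<Rightarrow> bool" where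
  "rank_function r \<rho> \<longleftrightarrow> (\<forall>z z'. covers r z z' \<longrightarrow> \<rho> z' = \<rho> z + 1)"

definition minimal_elt :: "'z set \<Rightarrow> 'z rel \<Rightarrow> 'z \<Rightarrow> bool" where
  "minimal_elt P r m \<longleftrightarrow> m \<in> P \<and> (\<forall>z\<in>P. (z, m) \<in> r \<longrightarrow> z = m)"

definition lower_eulerian :: "'z set \<Rightarrow> 'z rel \<Rightarrow> ('z \<Rightarrow> int) \<Rightarrow> bool" where
  "lower_eulerian P r \<rho> \<longleftrightarrow>
     finite P \<and> partial_order_on P r \<and> (\<exists>!m. minimal_elt P r m) \<and> rank_function r \<rho> \<and>
     (\<forall>z z'. (z, z') \<in> r \<and> z \<noteq> z' \<longrightarrow>
        (\<Sum>u | (z, u) \<in> r \<and> (u, z') \<in> r. (-1 :: real) powi \<rho> u) = 0)"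

definition zero_hat :: "'z set \<Rightarrow> 'z rel \<Rightarrow> 'z" where
  "zero_hat P r = (THE m. minimal_elt P r m)"

text \<open>The rank difference depends only on the order (\<open>rank_diff_eq\<close> below).\<close>

definition rank_diff :: "'z rel \<Rightarrow> 'z \<Rightarrow> 'z \<Rightarrow> int" where
  "rank_diff r z z' = (let \<rho> = (SOME \<rho>. rank_function r \<rho>) in \<rho> z' - \<rho> z)"

lemma rank_function_diff_unique:
  assumes "finite P" "partial_order_on P r" "rank_function r \<rho>" "rank_function r \<tau>" "(z, z') \<in> r"
  shows "\<rho> z' - \<rho> z = \<tau> z' - \<tau> z"
  using assms(5)
proof (induction "card {u. (z, u) \<in> r \<and> (u, z') \<in> r}" arbitrary: z z' rule: less_induct)
  case less
  have sub: "r \<subseteq> P \<times> P" and tr: "trans r" and as: "antisym r" and rf: "refl_on P r"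
    using assms(2) by (auto simp: partial_order_on_def preorder_on_def)
  have fin: "finite {u. (a, u) \<in> r \<and> (u, b) \<in> r}" for a b
    by (rule finite_subset[OF _ assms(1)]) (use sub in auto)
  show ?case
  proof (cases "z = z' \<or> covers r z z'")
    case True
    then show ?thesis using assms(3,4) by (auto simp: rank_function_def)
  next
    case False
    then obtain u where u: "(z, u) \<in> r" "(u, z') \<in> r" "u \<noteq> z" "u \<noteq> z'"
      using less.prems by (auto simp: covers_def)
    have rr: "(z, z) \<in> r" "(z', z') \<in> r"
      using rf sub less.prems by (auto simp: refl_on_def)
    have nz: "(u, z) \<notin> r" "(z', u) \<notin> r"
      using u as by (auto dest: antisymD)
    have "{v. (z, v) \<in> r \<and> (v, u) \<in> r} \<subset> {v. (z, v) \<in> r \<and> (v, z') \<in> r}"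
    proof
      show "{v. (z, v) \<in> r \<and> (v, u) \<in> r} \<subseteq> {v. (z, v) \<in> r \<and> (v, z') \<in> r}"
        using u(2) tr by (auto dest: transD)
      show "{v. (z, v) \<in> r \<and> (v, u) \<in> r} \<noteq> {v. (z, v) \<in> r \<and> (v, z') \<in> r}"
        using rr less.prems nz by auto
    qed
    moreover have "{v. (u, v) \<in> r \<and> (v, z') \<in> r} \<subset> {v. (z, v) \<in> r \<and> (v, z') \<in> r}"
    proof
      show "{v. (u, v) \<in> r \<and> (v, z') \<in> r} \<subseteq> {v. (z, v) \<in> r \<and> (v, z') \<in> r}"
        using u(1) tr by (auto dest: transD)
      show "{v. (u, v) \<in> r \<and> (v, z') \<in> r} \<noteq> {v. (z, v) \<in> r \<and> (v, z') \<in> r}"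
        using rr less.prems nz by auto
    qed
    ultimately have "card {v. (z, v) \<in> r \<and> (v, u) \<in> r} < card {v. (z, v) \<in> r \<and> (v, z') \<in> r}"
      "card {v. (u, v) \<in> r \<and> (v, z') \<in> r} < card {v. (z, v) \<in> r \<and> (v, z') \<in> r}"
      by (simp_all add: psubset_card_mono[OF fin])
    from less.hyps[OF this(1) u(1)] less.hyps[OF this(2) u(2)]
    have "\<rho> u - \<rho> z = \<tau> u - \<tau> z" "\<rho> z' - \<rho> u = \<tau> z' - \<tau> u" .
    then show ?thesis by simp
  qed
qed

lemma rank_diff_eq:
  assumes "finite P" "partial_order_on P r" "rank_function r \<rho>" "(z, z') \<in> r"
  shows "rank_diff r z z' = \<rho> z' - \<rho> z"
  unfolding rank_diff_def Let_def
  using rank_function_diff_unique[OF assms(1,2) someI[of "rank_function r", OF assms(3)] assms(3,4)] .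


section \<open>Strong formal subdivisions\<close>

definition strong_formal_subdivision ::
  "'a set \<Rightarrow> 'a rel \<Rightarrow> ('a \<Rightarrow> int) \<Rightarrow> 'b set \<Rightarrow> 'b rel \<Rightarrow> ('b \<Rightarrow> int) \<Rightarrow> ('a \<Rightarrow> 'b) \<Rightarrow> bool" where
  "strong_formal_subdivision X rX \<rho>X Y rY \<rho>Y \<sigma> \<longleftrightarrow>
     (\<forall>x x'. (x, x') \<in> rX \<longrightarrow> (\<sigma> x, \<sigma> x') \<in> rY) \<and>
     (\<forall>x\<in>X. \<rho>X x \<le> \<rho>Y (\<sigma> x)) \<and>
     \<sigma> ` X = Y \<and>
     (\<forall>x\<in>X. \<forall>y\<in>Y. (\<sigma> x, y) \<in> rY \<longrightarrow> (\<exists>x'. (x, x') \<in> rX \<and> \<rho>X x' = \<rho>Y y \<and> \<sigma> x' = y)) \<and>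
     (\<forall>x\<in>X. \<forall>y\<in>Y. (\<sigma> x, y) \<in> rY \<longrightarrow>
        (\<Sum>x' | (x, x') \<in> rX \<and> \<sigma> x' = y. (-1 :: real) powi (\<rho>Y y - \<rho>X x')) = 1)"

text \<open>The poset \<open>\<Gamma>\<close> has carrier \<^term>\<open>X <+> Y\<close>.\<close>

definition Gamma_order :: "'a set \<Rightarrow> 'a rel \<Rightarrow> 'b set \<Rightarrow> 'b rel \<Rightarrow> ('a \<Rightarrow> 'b) \<Rightarrow> ('a + 'b) rel" where
  "Gamma_order X rX Y rY \<sigma> =
     {(Inl x, Inl x') | x x'. (x, x') \<in> rX} \<union>
     {(Inr y, Inr y') | y y'. (y, y') \<in> rY} \<union>
     {(Inl x, Inr y) | x y. x \<in> X \<and> y \<in> Y \<and> (\<sigma> x, y) \<in> rY}"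

definition Gamma_rank :: "('a \<Rightarrow> int) \<Rightarrow> ('b \<Rightarrow> int) \<Rightarrow> 'a + 'b \<Rightarrow> int" where
  "Gamma_rank \<rho>X \<rho>Y = case_sum \<rho>X (\<lambda>y. \<rho>Y y + 1)"


section \<open>Eulerian actions\<close>

definition fixed_set :: "'z set \<Rightarrow> ('w \<Rightarrow> 'z \<Rightarrow> 'z) \<Rightarrow> 'w \<Rightarrow> 'z set" where
  "fixed_set P \<phi> w = {z \<in> P. \<phi> w z = z}"

definition fixed_order :: "'z set \<Rightarrow> 'z rel \<Rightarrow> ('w \<Rightarrow> 'z \<Rightarrow> 'z) \<Rightarrow> 'w \<Rightarrow> 'z rel" where
  "fixed_order P r \<phi> w = Restr r (fixed_set P \<phi> w)"

definition eulerian_action ::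
  "('w, 'm) monoid_scheme \<Rightarrow> 'z set \<Rightarrow> 'z rel \<Rightarrow> ('z \<Rightarrow> int) \<Rightarrow> ('w \<Rightarrow> 'z \<Rightarrow> 'z) \<Rightarrow> bool" where
  "eulerian_action W P r \<rho> \<phi> \<longleftrightarrow>
     group_action W P \<phi> \<and>
     (\<forall>w\<in>carrier W. \<forall>z z'. (z, z') \<in> r \<longrightarrow> (\<phi> w z, \<phi> w z') \<in> r) \<and>
     (\<forall>w\<in>carrier W. \<forall>z\<in>P. \<rho> (\<phi> w z) = \<rho> z) \<and>
     (\<forall>w\<in>carrier W. \<exists>\<rho>'. lower_eulerian (fixed_set P \<phi> w) (fixed_order P r \<phi> w) \<rho>')"

definition stab2 :: "('w, 'm) monoid_scheme \<Rightarrow> ('w \<Rightarrow> 'z \<Rightarrow> 'z) \<Rightarrow> 'z \<Rightarrow> 'z \<Rightarrow> 'w set" where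
  "stab2 W \<phi> z z' = stabilizer W \<phi> z \<inter> stabilizer W \<phi> z'"

definition stab3 :: "('w, 'm) monoid_scheme \<Rightarrow> ('w \<Rightarrow> 'z \<Rightarrow> 'z) \<Rightarrow> 'z \<Rightarrow> 'z \<Rightarrow> 'z \<Rightarrow> 'w set" where
  "stab3 W \<phi> z z'' z' = stabilizer W \<phi> z \<inter> stabilizer W \<phi> z'' \<inter> stabilizer W \<phi> z'"


section \<open>Representation rings\<close>

text \<open>For a subgroup \<open>H\<close> of \<open>W\<close>, the complex representation ring \<open>R(H)\<close> is realised as the ring of
  virtual characters: differences of characters of homomorphisms from \<open>H\<close> to \<open>GL\<^sub>n(\<complex>)\<close>.
  Class functions on \<open>H\<close> are stored as functions on the type of \<open>W\<close> that vanish off \<open>H\<close>;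
  ring operations are pointwise, and the unit of \<open>R(H)\<close> is \<^term>\<open>indicator H\<close>, not \<open>1\<close>.\<close>

definition complex_rep ::
  "('w, 'm) monoid_scheme \<Rightarrow> 'w set \<Rightarrow> nat \<Rightarrow> ('w \<Rightarrow> complex mat) \<Rightarrow> bool" where
  "complex_rep W H n R \<longleftrightarrow>
     R \<in> hom (W\<lparr>carrier := H\<rparr>) (units_of (ring_mat TYPE(complex) n ()))"

definition character :: "'w set \<Rightarrow> nat \<Rightarrow> ('w \<Rightarrow> complex mat) \<Rightarrow> 'w \<Rightarrow> complex" where
  "character H n R = (\<lambda>h. if h \<in> H then (\<Sum>i<n. R h $$ (i, i)) else 0)"

definition rep_ring :: "('w, 'm) monoid_scheme \<Rightarrow> 'w set \<Rightarrow> ('w \<Rightarrow> complex) set" where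
  "rep_ring W H =
     {character H n R - character H n' R' | n R n' R'. complex_rep W H n R \<and> complex_rep W H n' R'}"

definition Res :: "'w set \<Rightarrow> ('w \<Rightarrow> complex) \<Rightarrow> 'w \<Rightarrow> complex" where
  "Res H a = (\<lambda>w. if w \<in> H then a w else 0)"

text \<open>\<open>Ind W K H\<close> is induction from \<open>H\<close> to \<open>K\<close>, given by Frobenius' formula for the character of
  an induced representation.\<close>

definition Ind :: "('w, 'm) monoid_scheme \<Rightarrow> 'w set \<Rightarrow> 'w set \<Rightarrow> ('w \<Rightarrow> complex) \<Rightarrow> 'w \<Rightarrow> complex" where
  "Ind W K H a = (\<lambda>g. if g \<in> K
     then (\<Sum>k | k \<in> K \<and> inv\<^bsub>W\<^esub> k \<otimes>\<^bsub>W\<^esub> g \<otimes>\<^bsub>W\<^esub> k \<in> H. a (inv\<^bsub>W\<^esub> k \<otimes>\<^bsub>W\<^esub> g \<otimes>\<^bsub>W\<^esub> k)) / of_nat (card H)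
     else 0)"

text \<open>Elements of \<open>R(H)[t]\<close> are polynomials with coefficients in \<^term>\<open>rep_ring W H\<close>;
  restriction, induction and evaluation at \<open>w\<close> act on coefficients.\<close>

type_synonym 'w rpoly = "('w \<Rightarrow> complex) poly"

abbreviation Res_poly :: "'w set \<Rightarrow> 'w rpoly \<Rightarrow> 'w rpoly" where
  "Res_poly H \<equiv> map_poly (Res H)"

abbreviation Ind_poly :: "('w, 'm) monoid_scheme \<Rightarrow> 'w set \<Rightarrow> 'w set \<Rightarrow> 'w rpoly \<Rightarrow> 'w rpoly" where
  "Ind_poly W K H \<equiv> map_poly (Ind W K H)"

definition ev :: "'w \<Rightarrow> 'w rpoly \<Rightarrow> complex poly" where
  "ev w p = map_poly (\<lambda>a. a w) p"

definition const_fun :: "complex \<Rightarrow> 'w \<Rightarrow> complex" where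
  "const_fun c = (\<lambda>_. c)"


section \<open>The equivariant incidence algebra\<close>

text \<open>A function on intervals is stored as a function of two elements that is \<open>0\<close> on pairs that are
  not comparable in the order \<open>r\<close>.\<close>

type_synonym ('z, 'w) inc = "'z \<Rightarrow> 'z \<Rightarrow> 'w rpoly"

definition inc_alg ::
  "('w, 'm) monoid_scheme \<Rightarrow> ('w \<Rightarrow> 'z \<Rightarrow> 'z) \<Rightarrow> 'z rel \<Rightarrow> ('z, 'w) inc set" where
  "inc_alg W \<phi> r = {p.
     (\<forall>z z'. (z, z') \<notin> r \<longrightarrow> p z z' = 0) \<and>
     (\<forall>z z' i. (z, z') \<in> r \<longrightarrow> coeff (p z z') i \<in> rep_ring W (stab2 W \<phi> z z')) \<and>
     (\<forall>z z' i. (z, z') \<in> r \<longrightarrow> (\<forall>w\<in>carrier W. \<forall>u\<in>stab2 W \<phi> z z'.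
        coeff (p z z') i u =
        coeff (p (\<phi> w z) (\<phi> w z')) i (w \<otimes>\<^bsub>W\<^esub> u \<otimes>\<^bsub>W\<^esub> inv\<^bsub>W\<^esub> w)))}"

definition inc_mult ::
  "('w, 'm) monoid_scheme \<Rightarrow> ('w \<Rightarrow> 'z \<Rightarrow> 'z) \<Rightarrow> 'z rel \<Rightarrow>
   ('z, 'w) inc \<Rightarrow> ('z, 'w) inc \<Rightarrow> ('z, 'w) inc" where
  "inc_mult W \<phi> r p p' = (\<lambda>z z'. \<Sum>z'' | (z, z'') \<in> r \<and> (z'', z') \<in> r.
     Polynomial.smult (const_fun (of_nat (card (stab3 W \<phi> z z'' z')) / of_nat (card (stab2 W \<phi> z z'))))
       (Ind_poly W (stab2 W \<phi> z z') (stab3 W \<phi> z z'' z')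
         (Res_poly (stab3 W \<phi> z z'' z') (p z z'') * Res_poly (stab3 W \<phi> z z'' z') (p' z'' z'))))"

definition inc_one ::
  "('w, 'm) monoid_scheme \<Rightarrow> ('w \<Rightarrow> 'z \<Rightarrow> 'z) \<Rightarrow> 'z rel \<Rightarrow> ('z, 'w) inc" where
  "inc_one W \<phi> r = (\<lambda>z z'. if z = z' \<and> (z, z) \<in> r then [:indicator (stabilizer W \<phi> z):] else 0)"

definition inc_inverse ::
  "('w, 'm) monoid_scheme \<Rightarrow> ('w \<Rightarrow> 'z \<Rightarrow> 'z) \<Rightarrow> 'z rel \<Rightarrow> ('z, 'w) inc \<Rightarrow> ('z, 'w) inc \<Rightarrow> bool" where
  "inc_inverse W \<phi> r p q \<longleftrightarrow> q \<in> inc_alg W \<phi> r \<and>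
     inc_mult W \<phi> r p q = inc_one W \<phi> r \<and> inc_mult W \<phi> r q p = inc_one W \<phi> r"

definition inc_unipotent ::
  "('w, 'm) monoid_scheme \<Rightarrow> ('w \<Rightarrow> 'z \<Rightarrow> 'z) \<Rightarrow> 'z rel \<Rightarrow> ('z, 'w) inc set" where
  "inc_unipotent W \<phi> r =
     {p \<in> inc_alg W \<phi> r. \<forall>z. (z, z) \<in> r \<longrightarrow> p z z = [:indicator (stabilizer W \<phi> z):]}"

text \<open>Weak rank functions \<open>k\<close> are only constrained on comparable pairs.\<close>

definition weak_rank_function ::
  "('w, 'm) monoid_scheme \<Rightarrow> ('w \<Rightarrow> 'z \<Rightarrow> 'z) \<Rightarrow> 'z rel \<Rightarrow> ('z \<Rightarrow> 'z \<Rightarrow> nat) \<Rightarrow> bool" where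
  "weak_rank_function W \<phi> r k \<longleftrightarrow>
     (\<forall>z z'. (z, z') \<in> r \<and> z \<noteq> z' \<longrightarrow> k z z' > 0) \<and>
     (\<forall>z z'' z'. (z, z'') \<in> r \<and> (z'', z') \<in> r \<longrightarrow> k z z' = k z z'' + k z'' z') \<and>
     (\<forall>w\<in>carrier W. \<forall>z z'. (z, z') \<in> r \<longrightarrow> k (\<phi> w z) (\<phi> w z') = k z z')"

definition inc_alg_deg ::
  "('w, 'm) monoid_scheme \<Rightarrow> ('w \<Rightarrow> 'z \<Rightarrow> 'z) \<Rightarrow> 'z rel \<Rightarrow> ('z \<Rightarrow> 'z \<Rightarrow> nat) \<Rightarrow> ('z, 'w) inc set" where
  "inc_alg_deg W \<phi> r k = {p \<in> inc_alg W \<phi> r. \<forall>z z'. (z, z') \<in> r \<longrightarrow> degree (p z z') \<le> k z z'}"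

definition inc_alg_half ::
  "('w, 'm) monoid_scheme \<Rightarrow> ('w \<Rightarrow> 'z \<Rightarrow> 'z) \<Rightarrow> 'z rel \<Rightarrow> ('z \<Rightarrow> 'z \<Rightarrow> nat) \<Rightarrow> ('z, 'w) inc set" where
  "inc_alg_half W \<phi> r k = {p \<in> inc_alg_deg W \<phi> r k.
     \<forall>z z'. (z, z') \<in> r \<and> z \<noteq> z' \<longrightarrow> real (degree (p z z')) < real (k z z') / 2}"

text \<open>For \<open>p(z,z')\<close> of degree at most \<open>k(z,z')\<close> this is \<open>t\<^bsup>k(z,z')\<^esup> p(z,z'; t\<^bsup>-1\<^esup>)\<close>.\<close>

definition inc_rev :: "('z \<Rightarrow> 'z \<Rightarrow> nat) \<Rightarrow> ('z, 'w) inc \<Rightarrow> ('z, 'w) inc" where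
  "inc_rev k p = (\<lambda>z z'. \<Sum>i\<le>k z z'. monom (coeff (p z z') (k z z' - i)) i)"

text \<open>Only the values of the sign at \<open>w\<close> in \<open>W\<^bsub>z,z'\<^esub>\<close> matter, as coefficients vanish elsewhere.\<close>

definition inc_hat ::
  "'z set \<Rightarrow> ('w \<Rightarrow> 'z \<Rightarrow> 'z) \<Rightarrow> 'z rel \<Rightarrow> ('z, 'w) inc \<Rightarrow> ('z, 'w) inc" where
  "inc_hat P \<phi> r p = (\<lambda>z z'.
     map_poly (\<lambda>a w. (-1) powi rank_diff (fixed_order P r \<phi> w) z z' * a w) (p z z'))"

definition rank_alternating ::
  "'z set \<Rightarrow> ('w \<Rightarrow> 'z \<Rightarrow> 'z) \<Rightarrow> 'z rel \<Rightarrow> ('z \<Rightarrow> 'z \<Rightarrow> nat) \<Rightarrow> ('z, 'w) inc \<Rightarrow> bool" where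
  "rank_alternating P \<phi> r k p \<longleftrightarrow> inc_rev k p = inc_hat P \<phi> r p"

definition multiplicative ::
  "('w, 'm) monoid_scheme \<Rightarrow> 'z set \<Rightarrow> ('w \<Rightarrow> 'z \<Rightarrow> 'z) \<Rightarrow> 'z rel \<Rightarrow> ('z, 'w) inc \<Rightarrow> bool" where
  "multiplicative W P \<phi> r p \<longleftrightarrow> (\<forall>w\<in>carrier W. \<forall>z z'' z'.
     (z, z'') \<in> fixed_order P r \<phi> w \<and> (z'', z') \<in> fixed_order P r \<phi> w \<longrightarrow>
     ev w (p z z') = ev w (p z z'') * ev w (p z'' z'))"

definition inc_Delta ::
  "'z rel \<Rightarrow> ('z \<Rightarrow> 'z \<Rightarrow> nat) \<Rightarrow> ('z, 'w) inc \<Rightarrow> ('z, 'w) inc" where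
  "inc_Delta r k p = (\<lambda>z z'. if (z, z') \<in> r \<and> z \<noteq> z'
     then [:coeff (p z z') 0:] +
       (\<Sum>i = 1..(k z z' - 1) div 2. monom (coeff (p z z') i - coeff (p z z') (i - 1)) i)
     else 0)"


section \<open>Restrictions for a subdivision\<close>

definition restr_X :: "('a + 'b, 'w) inc \<Rightarrow> ('a + 'b, 'w) inc" where
  "restr_X p = (\<lambda>z z'. case (z, z') of (Inl x, Inl x') \<Rightarrow> p z z' | _ \<Rightarrow> 0)"

definition restr_Y :: "('a + 'b, 'w) inc \<Rightarrow> ('a + 'b, 'w) inc" where
  "restr_Y p = (\<lambda>z z'. case (z, z') of (Inr y, Inr y') \<Rightarrow> p z z' | _ \<Rightarrow> 0)"

definition restr_XY :: "('a + 'b, 'w) inc \<Rightarrow> ('a + 'b, 'w) inc" where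
  "restr_XY p = (\<lambda>z z'. case (z, z') of (Inl x, Inr y) \<Rightarrow> p z z' | _ \<Rightarrow> 0)"

definition restr_XY_interior :: "('a \<Rightarrow> 'b) \<Rightarrow> ('a + 'b, 'w) inc \<Rightarrow> ('a + 'b, 'w) inc" where
  "restr_XY_interior \<sigma> p =
     (\<lambda>z z'. case (z, z') of (Inl x, Inr y) \<Rightarrow> if y = \<sigma> x then p z z' else 0 | _ \<Rightarrow> 0)"

end

theory Submission
  imports Defs
begin

text \<open>Evaluating characters at \<open>w\<close> turns the equivariant product into the ordinary convolution on the
  fixed poset \<open>\<Gamma>\<^sup>w\<close>, so all identities can be checked there. On \<open>\<Gamma>\<^sup>w\<close>, multiplicativity and the
  Eulerian property make the sign twist of \<open>\<kappa>\<close> its inverse. The product of \<open>g\<close> with the sign twist of \<open>f\<close> is then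
  palindromic; having degree below half, it is the identity, so the sign twist of \<open>f\<close> is \<open>g\<^sup>-\<^sup>1\<close>.
  Put \<open>D = g|\<^bsub>X/Y\<^esub> g\<^sup>-\<^sup>1|\<^sub>Y\<close>. Since \<open>\<kappa>(x,y) = \<kappa>(x,\<sigma>(x)) \<kappa>(\<sigma>(x),y)\<close>, restricting \<open>g\<^sup>r\<^sup>e\<^sup>v = g \<kappa>\<close> to
  \<open>X/Y\<close> gives \<open>D\<^sup>r\<^sup>e\<^sup>v - D = (t - 1) l\<close>. As \<open>D\<close> has degree below half, comparing the lower coefficients
  yields \<open>D = \<Delta>l\<close>, and the three identities are block matrix computations with \<open>D\<close>.\<close>

section \<open>Kernels in ordinary incidence algebras\<close>

text \<open>The sign in the twist depends on w, but for a fixed w it splits as (-1)^rank(z) *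
  (-1)^rank(z'). The twist is then conjugation by a diagonal sign matrix, so it respects products;
  this is how the defining equation of f becomes an equation about an inverse of g. For the blocks X
  and Y to survive the passage to fixed points, W has to preserve both and commute with \<sigma>.
  Both facts are read off from the order: Y consists of the elements above the fixed point
  \<open>zero_hat\<close>, and \<sigma>(x) is the least element of Y above x. The operator \<Delta>
  is what solving D^rev - D = (t - 1) l for D produces: strictly below half the weak rank D^rev has
  only zero coefficients, and from there on D has only zero coefficients.\<close>

definition rev_poly :: "nat \<Rightarrow> 'c::comm_monoid_add poly \<Rightarrow> 'c poly" where
  "rev_poly n p = (\<Sum>i\<le>n. monom (coeff p (n - i)) i)"

lemma coeff_rev_poly: "coeff (rev_poly n p) i = (if i \<le> n then coeff p (n - i) else 0)"
  by (simp add: rev_poly_def coeff_sum)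

lemma rev_poly_0 [simp]: "rev_poly n 0 = 0"
  by (simp add: rev_poly_def)

lemma rev_poly_sum: "rev_poly n (\<Sum>i\<in>I. p i) = (\<Sum>i\<in>I. rev_poly n (p i))"
  by (intro poly_eqI) (simp add: coeff_rev_poly coeff_sum)

lemma rev_poly_smult: "rev_poly n (Polynomial.smult a p) = Polynomial.smult a (rev_poly n p)"
  by (intro poly_eqI) (simp add: coeff_rev_poly)

text \<open>Reversal at a bound n is \<open>reflect_poly\<close>, which reverses at the actual
  degree, times the missing power of t. Over a domain degrees add, so these powers multiply
  correctly and the multiplicativity of \<open>reflect_poly\<close> carries over.\<close>

lemma rev_poly_mult:
  fixes p q :: "'c::idom poly"
  assumes "degree p \<le> m" "degree q \<le> n"
  shows "rev_poly (m + n) (p * q) = rev_poly m p * rev_poly n q"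
proof -
  have refl: "rev_poly n p = monom 1 (n - degree p) * reflect_poly p"
    if "degree p \<le> n" for n and p :: "'c poly"
    using that
    by (intro poly_eqI)
       (auto simp: coeff_rev_poly coeff_monom_mult coeff_reflect_poly intro!: coeff_eq_0 arg_cong[of _ _ "coeff p"])
  show ?thesis
  proof (cases "p = 0 \<or> q = 0")
    case False
    then have "degree (p * q) = degree p + degree q" by (simp add: degree_mult_eq)
    moreover from this assms have "monom (1::'c) (m + n - degree (p * q)) =
        monom 1 (m - degree p) * monom 1 (n - degree q)"
      by (simp add: mult_monom)
    ultimately show ?thesis using assms
      by (simp add: refl reflect_poly_mult mult_ac)
  qed auto
qed

text \<open>The reflection i -> n - i sends every index up to the degree to one above the degree,
  where the coefficient is zero.\<close>

lemma half_palindrome_eq_0: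
  assumes "rev_poly n p = p" "2 * degree p < n"
  shows "p = 0"
proof (rule poly_eqI)
  fix i
  have "coeff p i = (if i \<le> n then coeff p (n - i) else 0)"
    using assms(1) coeff_rev_poly[of n p i] by simp
  with assms(2) show "coeff p i = coeff 0 i"
    by (cases "i \<le> degree p") (auto simp: coeff_eq_0)
qed

section \<open>Matrix products over a chosen index set\<close>

definition conv :: "'z set \<Rightarrow> ('z \<Rightarrow> 'z \<Rightarrow> 'c::comm_semiring_0) \<Rightarrow> ('z \<Rightarrow> 'z \<Rightarrow> 'c) \<Rightarrow> 'z \<Rightarrow> 'z \<Rightarrow> 'c" where
  "conv A p q = (\<lambda>z z'. \<Sum>u\<in>A. p z u * q u z')"

text \<open>The two index sets are independent. This allows block computations in which one middle
  index runs over a block and the other over the whole poset.\<close>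

lemma conv_assoc: "conv B (conv C p q) t = conv C p (conv B q t)"
  by (intro ext) (simp add: conv_def sum_distrib_left sum_distrib_right mult.assoc sum.swap[of _ C])

lemma conv_cong:
  assumes "\<And>u. u \<in> B \<Longrightarrow> p z u * q u z' = p' z u * q' u z'"
  shows "conv B p q z z' = conv B p' q' z z'"
  using assms by (auto simp: conv_def intro: sum.cong)

lemma conv_eq_0:
  assumes "\<And>u. u \<in> B \<Longrightarrow> p z u * q u z' = 0"
  shows "conv B p q z z' = 0"
  using assms by (simp add: conv_def)

lemma conv_outside:
  assumes "trans r" "(z, z') \<notin> r"
    and "\<And>u. (z, u) \<notin> r \<Longrightarrow> p z u = 0" "\<And>u. (u, z') \<notin> r \<Longrightarrow> q u z' = 0"
  shows "conv B p q z z' = 0"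
proof (rule conv_eq_0)
  fix u
  have "(z, u) \<notin> r \<or> (u, z') \<notin> r" using assms(1,2) by (auto dest: transD)
  then show "p z u * q u z' = 0" using assms(3,4) by auto
qed

lemma conv_delta_right:
  fixes p q :: "'z \<Rightarrow> 'z \<Rightarrow> 'c::comm_semiring_1"
  assumes "finite B" "z' \<in> B" "\<And>u. u \<in> B \<Longrightarrow> q u z' = (if u = z' then 1 else 0)"
  shows "conv B p q z z' = p z z'"
proof -
  have "conv B p q z z' = (\<Sum>u\<in>B. if u = z' then p z u else 0)"
    unfolding conv_def by (intro sum.cong) (auto simp: assms(3))
  then show ?thesis using assms(1,2) by simp
qed

lemma conv_delta_left:
  fixes p q :: "'z \<Rightarrow> 'z \<Rightarrow> 'c::comm_semiring_1"
  assumes "finite B" "z \<in> B" "\<And>u. u \<in> B \<Longrightarrow> p z u = (if u = z then 1 else 0)"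
  shows "conv B p q z z' = q z z'"
proof -
  have "conv B p q z z' = (\<Sum>u\<in>B. if u = z then q u z' else 0)"
    unfolding conv_def by (intro sum.cong) (auto simp: assms(3))
  then show ?thesis using assms(1,2) by simp
qed

section \<open>Sign twists and kernels on a signed poset\<close>

definition sgn_twist :: "('z \<Rightarrow> 'c) \<Rightarrow> ('z \<Rightarrow> 'z \<Rightarrow> 'c::comm_ring_1 poly) \<Rightarrow> 'z \<Rightarrow> 'z \<Rightarrow> 'c poly" where
  "sgn_twist c p = (\<lambda>z z'. Polynomial.smult (c z * c z') (p z z'))"

text \<open>\<open>sgn_twist c\<close> is conjugation by the diagonal matrix with entries c; the two
  factors \<open>c u\<close> at the middle index cancel.\<close>

lemma conv_sgn_twist:
  assumes "\<And>u. u \<in> B \<Longrightarrow> c u * c u = 1"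
  shows "conv B (sgn_twist c p) (sgn_twist c q) = sgn_twist c (conv B p q)"
proof (intro ext)
  fix z z'
  have "Polynomial.smult (c z * c u) (p z u) * Polynomial.smult (c u * c z') (q u z') =
      Polynomial.smult (c z * c z') (p z u * q u z')" if "u \<in> B" for u
  proof -
    have "c z * c u * (c u * c z') = (c u * c u) * (c z * c z')" by (simp only: mult_ac)
    then show ?thesis using assms[OF that] by (simp add: mult_ac)
  qed
  then show "conv B (sgn_twist c p) (sgn_twist c q) z z' = sgn_twist c (conv B p q) z z'"
    by (intro poly_eqI) (simp add: conv_def sgn_twist_def coeff_sum sum_distrib_left)
qed

text \<open>Abstracts the situation at one group element w: A and r become the fixed points of w
  with their order, \<open>c z\<close> the sign (-1)^rank, and \<kappa>, f, g the evaluated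
  polynomials. "Degree below half" is written with a factor 2 to stay in the naturals.\<close>

locale incidence_kernel =
  fixes A :: "'z set" and r :: "'z rel" and k :: "'z \<Rightarrow> 'z \<Rightarrow> nat" and c :: "'z \<Rightarrow> 'c::idom"
    and \<kappa> f g :: "'z \<Rightarrow> 'z \<Rightarrow> 'c poly"
  assumes finite_A: "finite A" and po: "partial_order_on A r"
    and k_add: "(z, u) \<in> r \<Longrightarrow> (u, z') \<in> r \<Longrightarrow> k z z' = k z u + k u z'"
    and sign: "z \<in> A \<Longrightarrow> c z * c z = 1"
    and eulerian: "(z, z') \<in> r \<Longrightarrow> z \<noteq> z' \<Longrightarrow> (\<Sum>u | (z, u) \<in> r \<and> (u, z') \<in> r. c u) = 0"
    and supp: "(z, z') \<notin> r \<Longrightarrow> \<kappa> z z' = 0" "(z, z') \<notin> r \<Longrightarrow> f z z' = 0" "(z, z') \<notin> r \<Longrightarrow> g z z' = 0"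
    and diag: "z \<in> A \<Longrightarrow> \<kappa> z z = 1" "z \<in> A \<Longrightarrow> f z z = 1" "z \<in> A \<Longrightarrow> g z z = 1"
    and \<kappa>_mult: "(z, u) \<in> r \<Longrightarrow> (u, z') \<in> r \<Longrightarrow> \<kappa> z z' = \<kappa> z u * \<kappa> u z'"
    and f_deg: "(z, z') \<in> r \<Longrightarrow> z \<noteq> z' \<Longrightarrow> 2 * degree (f z z') < k z z'"
    and g_deg: "(z, z') \<in> r \<Longrightarrow> z \<noteq> z' \<Longrightarrow> 2 * degree (g z z') < k z z'"
    and f_rev: "(z, z') \<in> r \<Longrightarrow> rev_poly (k z z') (f z z') = conv A \<kappa> f z z'"
    and g_rev: "(z, z') \<in> r \<Longrightarrow> rev_poly (k z z') (g z z') = conv A g \<kappa> z z'"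
begin

lemma r_refl: "z \<in> A \<Longrightarrow> (z, z) \<in> r" and r_sub: "(z, z') \<in> r \<Longrightarrow> z \<in> A \<and> z' \<in> A"
  and r_trans: "(z, u) \<in> r \<Longrightarrow> (u, z') \<in> r \<Longrightarrow> (z, z') \<in> r"
  and r_antisym: "(z, z') \<in> r \<Longrightarrow> (z', z) \<in> r \<Longrightarrow> z = z'"
  and trans_r: "trans r"
  using po by (auto simp: partial_order_on_def preorder_on_def refl_on_def dest: transD antisymD)

abbreviation rv :: "('z \<Rightarrow> 'z \<Rightarrow> 'c poly) \<Rightarrow> 'z \<Rightarrow> 'z \<Rightarrow> 'c poly" where
  "rv p \<equiv> \<lambda>z z'. rev_poly (k z z') (p z z')"

abbreviation \<gamma> :: "'z \<Rightarrow> 'z \<Rightarrow> 'c poly" where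
  "\<gamma> \<equiv> sgn_twist c f"

lemma \<gamma>_supp: "(z, z') \<notin> r \<Longrightarrow> \<gamma> z z' = 0" and \<gamma>_diag: "z \<in> A \<Longrightarrow> \<gamma> z z = 1"
  and \<gamma>_deg: "(z, z') \<in> r \<Longrightarrow> z \<noteq> z' \<Longrightarrow> 2 * degree (\<gamma> z z') < k z z'"
proof -
  show "(z, z') \<notin> r \<Longrightarrow> \<gamma> z z' = 0" "z \<in> A \<Longrightarrow> \<gamma> z z = 1"
    by (simp_all add: sgn_twist_def supp diag sign)
  show "(z, z') \<in> r \<Longrightarrow> z \<noteq> z' \<Longrightarrow> 2 * degree (\<gamma> z z') < k z z'"
    using f_deg[of z z'] degree_smult_le[of "c z * c z'" "f z z'"] unfolding sgn_twist_def by linarith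
qed

text \<open>The weak bounds hold for all pairs: on the diagonal of A the polynomials are 1, and off
  the order they are 0.\<close>

lemma deg_le: "2 * degree (f z z') \<le> k z z'" "2 * degree (g z z') \<le> k z z'" "2 * degree (\<gamma> z z') \<le> k z z'"
  using f_deg[of z z'] g_deg[of z z'] \<gamma>_deg[of z z'] supp(2,3)[of z z'] \<gamma>_supp[of z z']
    diag(2,3)[of z] \<gamma>_diag[of z] r_sub[of z z']
  by (cases "(z, z') \<in> r"; cases "z = z'"; force)+

lemma deg_le': "degree (f z z') \<le> k z z'" "degree (g z z') \<le> k z z'" "degree (\<gamma> z z') \<le> k z z'"
  using deg_le[of z z'] by linarith+

lemma twist_\<gamma>: "sgn_twist c \<gamma> = f"
proof (intro ext)
  fix z z'
  show "sgn_twist c \<gamma> z z' = f z z'"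
  proof (cases "(z, z') \<in> r")
    case True
    have "c z * c z' * (c z * c z') = (c z * c z) * (c z' * c z')" by (simp only: mult_ac)
    then show ?thesis using r_sub[OF True] by (simp add: sgn_twist_def sign)
  qed (simp add: sgn_twist_def supp)
qed

text \<open>Holds term by term, since k is additive along comparable triples and all other terms are
  zero before and after reversal. The assumptions speak only about indices in B, so the rule also
  applies to a block product whose factors are controlled on that block alone.\<close>

lemma rv_conv:
  assumes "\<And>u. u \<in> B \<Longrightarrow> (z, u) \<notin> r \<Longrightarrow> p z u = 0" "\<And>u. u \<in> B \<Longrightarrow> (u, z') \<notin> r \<Longrightarrow> q u z' = 0"
    and "\<And>u. u \<in> B \<Longrightarrow> (z, u) \<in> r \<Longrightarrow> degree (p z u) \<le> k z u"
    and "\<And>u. u \<in> B \<Longrightarrow> (u, z') \<in> r \<Longrightarrow> degree (q u z') \<le> k u z'"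
  shows "rv (conv B p q) z z' = conv B (rv p) (rv q) z z'"
proof -
  have "rev_poly (k z z') (p z u * q u z') = rev_poly (k z u) (p z u) * rev_poly (k u z') (q u z')"
    if "u \<in> B" for u
  proof (cases "(z, u) \<in> r \<and> (u, z') \<in> r")
    case True
    then have "k z z' = k z u + k u z'" using k_add by blast
    then show ?thesis using True assms(3,4)[OF that] by (simp add: rev_poly_mult)
  next
    case False
    then show ?thesis using assms(1,2)[OF that] by auto
  qed
  then show ?thesis by (simp add: conv_def rev_poly_sum)
qed

lemma conv_degree:
  assumes "(z, z') \<in> r" "z \<noteq> z'" "\<And>u. u \<in> B \<Longrightarrow> (z, u) \<in> r \<Longrightarrow> (u, z') \<in> r \<Longrightarrow> 2 * degree (p z u * q u z') < k z z'"
    and "\<And>u. u \<in> B \<Longrightarrow> (z, u) \<notin> r \<or> (u, z') \<notin> r \<Longrightarrow> p z u * q u z' = 0"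
  shows "2 * degree (conv B p q z z') < k z z'"
proof -
  have k: "k z z' > 0" using g_deg[OF assms(1,2)] by simp
  \<comment> \<open>Rounding k/2 up turns \<open>2 * d < k\<close> into a plain strict bound on d.
    It is positive because k is, so zero terms and empty sums satisfy it too.\<close>
  have "degree (p z u * q u z') < (k z z' + 1) div 2" if "u \<in> B" for u
    using assms(3,4)[OF that] k by (cases "(z, u) \<in> r \<and> (u, z') \<in> r") auto
  then have "degree (conv B p q z z') < (k z z' + 1) div 2"
    unfolding conv_def using k by (intro degree_sum_less) auto
  then show ?thesis by linarith
qed

text \<open>Degrees add along the middle index u. Both factors satisfy the weak bound, and as z and
  z' differ, u differs from one of them, which makes one bound strict. The index set B is arbitrary,
  so the bound covers the full product as well as its T block.\<close>

lemma g_\<gamma>_degree: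
  assumes "(z, z') \<in> r" "z \<noteq> z'"
  shows "2 * degree (conv B g \<gamma> z z') < k z z'"
proof (rule conv_degree[OF assms])
  fix u assume "(z, u) \<in> r" "(u, z') \<in> r"
  have "2 * (degree (g z u) + degree (\<gamma> u z')) < k z u + k u z'"
    using \<open>(z, u) \<in> r\<close> \<open>(u, z') \<in> r\<close> g_deg[of z u] \<gamma>_deg[of u z'] deg_le[of z u] deg_le[of u z'] assms(2)
    by (cases "z = u") force+
  also have "\<dots> = k z z'"
    using k_add \<open>(z, u) \<in> r\<close> \<open>(u, z') \<in> r\<close> by simp
  finally show "2 * degree (g z u * \<gamma> u z') < k z z'"
    by (rule le_less_trans[OF mult_le_mono2[OF degree_mult_le]])
qed (use supp \<gamma>_supp in auto)

text \<open>By multiplicativity each u in the interval contributes the same polynomial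
  \<open>\<kappa> z z'\<close>, up to the sign \<open>c u * c z'\<close>. What remains is the
  alternating sum over the interval, which is zero unless z = z'.\<close>

lemma conv_\<kappa>_twist: 
  assumes "z \<in> A" "z' \<in> A"
  shows "conv A \<kappa> (sgn_twist c \<kappa>) z z' = (if z = z' then 1 else 0)"
proof -
  have eq: "conv A \<kappa> (sgn_twist c \<kappa>) z z' =
      Polynomial.smult ((\<Sum>u | (z, u) \<in> r \<and> (u, z') \<in> r. c u) * c z') (\<kappa> z z')"
  proof -
    have "conv A \<kappa> (sgn_twist c \<kappa>) z z' =
        (\<Sum>u | (z, u) \<in> r \<and> (u, z') \<in> r. Polynomial.smult (c u * c z') (\<kappa> z z'))"
      unfolding conv_def
    proof (rule sum.mono_neutral_cong_right[OF finite_A])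
      show "\<forall>i\<in>A - {u. (z, u) \<in> r \<and> (u, z') \<in> r}. \<kappa> z i * sgn_twist c \<kappa> i z' = 0"
        using supp(1) by (auto simp: sgn_twist_def)
    qed (use r_sub \<kappa>_mult in \<open>auto simp: sgn_twist_def\<close>)
    then show ?thesis by (simp add: smult_sum sum_distrib_right)
  qed
  show ?thesis
  proof (cases "(z, z') \<in> r")
    case True
    have "{u. (z, u) \<in> r \<and> (u, z) \<in> r} = {z}"
      using r_refl assms r_antisym by auto
    then show ?thesis
      using eq True eulerian[OF True] assms by (auto simp: diag sign)
  next
    case False
    then show ?thesis using eq supp r_refl assms by auto
  qed
qed

lemma \<gamma>_rv: "rv \<gamma> z z' = conv A (sgn_twist c \<kappa>) \<gamma> z z'"
proof -
  have "rv \<gamma> z z' = sgn_twist c (conv A \<kappa> f) z z'"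
  proof (cases "(z, z') \<in> r")
    case True
    then show ?thesis by (simp add: sgn_twist_def rev_poly_smult f_rev)
  next
    case False
    have "conv A \<kappa> f z z' = 0"
      using False trans_r supp by (intro conv_outside)
    with False show ?thesis by (simp add: sgn_twist_def supp)
  qed
  then show ?thesis by (simp add: conv_sgn_twist sign)
qed

lemma g_rv: "rv g z z' = conv A g \<kappa> z z'"
proof (cases "(z, z') \<in> r")
  case False
  have "conv A g \<kappa> z z' = 0"
    using False trans_r supp by (intro conv_outside)
  with False show ?thesis by (simp add: supp)
qed (simp add: g_rev)

text \<open>Twisting f^rev = \<kappa> f gives \<gamma>^rev as the twisted kernel times \<gamma>, and
  \<kappa> cancels the twisted kernel.\<close>

lemma conv_\<kappa>_rv_\<gamma>:
  assumes "z \<in> A"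
  shows "conv A \<kappa> (rv \<gamma>) z z' = \<gamma> z z'"
proof -
  have "conv A \<kappa> (rv \<gamma>) z z' = conv A (conv A \<kappa> (sgn_twist c \<kappa>)) \<gamma> z z'"
    by (simp add: \<gamma>_rv conv_assoc)
  then show ?thesis
    using assms finite_A conv_\<kappa>_twist by (simp add: conv_delta_left)
qed

text \<open>The palindrome is (g \<gamma>)^rev = (g \<kappa>) \<gamma>^rev = g (\<kappa>
  \<gamma>^rev) = g \<gamma>.\<close>

lemma conv_g_\<gamma>:
  assumes "z \<in> A" "z' \<in> A"
  shows "conv A g \<gamma> z z' = (if z = z' then 1 else 0)"
proof (cases "(z, z') \<in> r \<and> z \<noteq> z'")
  case True
  have "rv (conv A g \<gamma>) z z' = conv A (rv g) (rv \<gamma>) z z'"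
    by (rule rv_conv) (use supp \<gamma>_supp deg_le' in auto)
  also have "\<dots> = conv A g (conv A \<kappa> (rv \<gamma>)) z z'"
    by (simp add: g_rv conv_assoc)
  also have "\<dots> = conv A g \<gamma> z z'"
    by (rule conv_cong) (simp add: conv_\<kappa>_rv_\<gamma>)
  finally show ?thesis
    using True g_\<gamma>_degree[of z z' A] half_palindrome_eq_0[of "k z z'" "conv A g \<gamma> z z'"] by simp
next
  case False
  show ?thesis
  proof (cases "z = z'")
    case True
    have "conv A g \<gamma> z z = (\<Sum>u\<in>A. if u = z then 1 else 0)"
      unfolding conv_def using assms(1) r_antisym
      by (intro sum.cong) (auto simp: diag(3) \<gamma>_diag, metis supp(3) \<gamma>_supp)
    then show ?thesis using True assms finite_A by simp
  next
    case neq: False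
    with False have "conv A g \<gamma> z z' = 0"
      using assms r_refl trans_r supp \<gamma>_supp by (intro conv_outside) auto
    with neq show ?thesis by simp
  qed
qed

text \<open>Uniqueness of inverses: q = q (g \<gamma>) = (q g) \<gamma> = \<gamma>. It identifies
  the inverse of g that enters the definition of l with the twist of f.\<close>

lemma left_inverse_eq:
  assumes "z \<in> A" "z' \<in> A"
    and inv: "\<And>u. u \<in> A \<Longrightarrow> conv A q g z u = (if z = u then 1 else 0)"
  shows "q z z' = \<gamma> z z'"
proof -
  have "q z z' = conv A q (conv A g \<gamma>) z z'"
    using assms finite_A by (simp add: conv_g_\<gamma> conv_delta_right)
  also have "\<dots> = conv A (conv A q g) \<gamma> z z'" by (simp add: conv_assoc)
  also have "\<dots> = \<gamma> z z'" using assms finite_A by (simp add: conv_delta_left)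
  finally show ?thesis .
qed

end


text \<open>S and T stand for the fixed points in X and in Y, and s for \<sigma>, viewed as the map
  to the least element of T above a point. The polynomial \<open>[:-1, 1:]\<close> is t - 1. The
  inverse of g is constrained only inside A, apart from its zero columns off A, which make l zero
  there as well.\<close>

locale subdivided_kernel = incidence_kernel A r k c \<kappa> f g
  for A :: "'z set" and r k and c :: "'z \<Rightarrow> 'c::idom" and \<kappa> f g +
  fixes S T :: "'z set" and s :: "'z \<Rightarrow> 'z" and h l g_inv :: "'z \<Rightarrow> 'z \<Rightarrow> 'c poly"
  assumes A_eq: "A = S \<union> T" and disj: "S \<inter> T = {}"
    and upper: "(y, z) \<in> r \<Longrightarrow> y \<in> T \<Longrightarrow> z \<in> T"
    and s: "x \<in> S \<Longrightarrow> s x \<in> T" "x \<in> S \<Longrightarrow> (x, s x) \<in> r"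
    and s_least: "x \<in> S \<Longrightarrow> y \<in> T \<Longrightarrow> (x, y) \<in> r \<Longrightarrow> (s x, y) \<in> r"
    and h: "[:-1, 1:] * h z z' = conv A g (\<lambda>x y. if x \<in> S \<and> y = s x then \<kappa> x y else 0) z z'"
    and g_inv: "z \<in> A \<Longrightarrow> z' \<in> A \<Longrightarrow> conv A g_inv g z z' = (if z = z' then 1 else 0)"
    and l_g_inv: "l z z' = conv A h g_inv z z'" and g_inv_supp: "z' \<notin> A \<Longrightarrow> g_inv z z' = 0"
begin

section \<open>Block triangularity\<close>

lemma finite_ST: "finite S" "finite T" and ST_A: "z \<in> S \<Longrightarrow> z \<in> A" "z \<in> T \<Longrightarrow> z \<in> A"
  and T_not_S: "z \<in> T \<Longrightarrow> z \<notin> S" and T_S_not_r: "y \<in> T \<Longrightarrow> z \<in> S \<Longrightarrow> (y, z) \<notin> r"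
  using finite_A A_eq disj upper by auto

lemma conv_split: "conv A p q z z' = conv S p q z z' + conv T p q z z'"
  unfolding conv_def A_eq using finite_ST disj by (simp add: sum.union_disjoint)

text \<open>T is closed upwards, so nothing in T lies below a point of S. Hence a column indexed by
  S sees only S, and dually a row indexed by T sees only T.\<close>

lemma conv_eq_conv_S:
  assumes "z' \<in> S" "\<And>u z'. (u, z') \<notin> r \<Longrightarrow> q u z' = 0"
  shows "conv A p q z z' = conv S p q z z'"
proof -
  have "conv T p q z z' = 0" by (rule conv_eq_0) (simp add: assms T_S_not_r)
  then show ?thesis by (simp add: conv_split)
qed

lemma conv_eq_conv_T:
  assumes "z \<in> T" "\<And>z u. (z, u) \<notin> r \<Longrightarrow> p z u = 0"
  shows "conv A p q z z' = conv T p q z z'"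
proof -
  have "conv S p q z z' = 0" by (rule conv_eq_0) (simp add: assms T_S_not_r)
  then show ?thesis by (simp add: conv_split)
qed

lemma g_inv_eq_\<gamma>: "z \<in> A \<Longrightarrow> z' \<in> A \<Longrightarrow> g_inv z z' = \<gamma> z z'"
  by (rule left_inverse_eq) (simp_all add: g_inv)

lemma conv_\<gamma>_g:
  assumes "z \<in> A" "z' \<in> A"
  shows "conv A \<gamma> g z z' = (if z = z' then 1 else 0)"
proof -
  have "conv A \<gamma> g z z' = conv A g_inv g z z'"
    using g_inv_eq_\<gamma> assms by (intro conv_cong) simp
  then show ?thesis using g_inv assms by simp
qed

lemma l: "l z z' = conv A h \<gamma> z z'"
proof (cases "z' \<in> A")
  case True
  then show ?thesis unfolding l_g_inv using g_inv_eq_\<gamma> by (intro conv_cong) simp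
next
  case False
  then have "(u, z') \<notin> r" for u using r_sub by blast
  then show ?thesis unfolding l_g_inv using False by (simp add: conv_def g_inv_supp \<gamma>_supp)
qed

section \<open>The off-diagonal block D and its coefficients\<close>

definition D :: "'z \<Rightarrow> 'z \<Rightarrow> 'c poly" where
  "D = conv T g \<gamma>"

text \<open>The entry of g \<gamma> = 1 at (x, y) is zero, so the contributions of S and T to the
  middle index cancel. This second form of D is the one suited to f.\<close>

lemma D_eq:
  assumes "x \<in> S" "y \<in> T"
  shows "D x y = - conv S g \<gamma> x y"
proof -
  have "x \<noteq> y" using assms T_not_S by blast
  then have "conv S g \<gamma> x y + D x y = 0"
    using conv_g_\<gamma>[of x y] assms ST_A by (simp add: conv_split D_def)
  then show ?thesis by (simp add: eq_neg_iff_add_eq_0 add.commute)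
qed

lemma D_degree:
  assumes "x \<in> S" "y \<in> T" "(x, y) \<in> r"
  shows "2 * degree (D x y) < k x y"
  unfolding D_def
proof (rule g_\<gamma>_degree)
qed (use assms T_not_S in auto)

lemma D_outside: "(x, y) \<notin> r \<Longrightarrow> D x y = 0"
  unfolding D_def using trans_r supp \<gamma>_supp by (intro conv_outside)

text \<open>By triangularity the T block of \<gamma> is inverse to the T block of g, so the factor
  \<gamma> in D is cancelled by g.\<close>

lemma g_eq_D:
  assumes "x \<in> S" "y \<in> T"
  shows "conv T D g x y = g x y"
proof -
  have "conv T D g x y = conv T g (conv T \<gamma> g) x y" by (simp add: D_def conv_assoc)
  also have "\<dots> = g x y"
    using assms finite_ST ST_A conv_\<gamma>_g \<gamma>_supp by (simp add: conv_delta_right flip: conv_eq_conv_T)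
  finally show ?thesis .
qed

text \<open>In the form \<open>- conv S g \<gamma>\<close>, D twists to minus the twist of g times
  f. On the S block, f times the twist of g is the twist of \<gamma> g, that is, the identity, and
  only f is left.\<close>

lemma f_eq_D:
  assumes "x \<in> S" "y \<in> T"
  shows "f x y = - conv S f (sgn_twist c D) x y"
proof -
  have "conv S f (sgn_twist c D) x y = - conv S f (sgn_twist c (conv S g \<gamma>)) x y"
    using assms by (simp add: conv_def sgn_twist_def D_eq sum_negf)
  also have "sgn_twist c (conv S g \<gamma>) = conv S (sgn_twist c g) f"
    using conv_sgn_twist[of S c g \<gamma>] ST_A by (simp add: sign twist_\<gamma>)
  also have "conv S f (conv S (sgn_twist c g) f) x y = conv S (conv S f (sgn_twist c g)) f x y"
    by (simp add: conv_assoc)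
  also have "\<dots> = f x y"
  proof (rule conv_delta_left)
    fix u assume u: "u \<in> S"
    have "conv S f (sgn_twist c g) = sgn_twist c (conv S \<gamma> g)"
      using conv_sgn_twist[of S c \<gamma> g] ST_A by (simp add: sign twist_\<gamma>)
    then have "conv S f (sgn_twist c g) x u = sgn_twist c (conv A \<gamma> g) x u"
      using u supp by (simp add: sgn_twist_def[of c "conv _ _ _"] conv_eq_conv_S)
    also have "\<dots> = (if u = x then 1 else 0)"
      using u assms ST_A by (simp add: sgn_twist_def[of c "conv _ _ _"] conv_\<gamma>_g sign)
    finally show "conv S f (sgn_twist c g) x u = (if u = x then 1 else 0)" .
  qed (use assms finite_ST in auto)
  finally show ?thesis by simp
qed

text \<open>Only (t - 1) h is given, so t - 1 is cancelled in a polynomial domain. In the product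
  the factor \<kappa> needs a middle index in S, which forces z into S as T is closed upwards, and
  it ends in T because s does.\<close>

lemma h_outside: "z \<notin> S \<or> z' \<notin> T \<Longrightarrow> h z z' = 0"
proof -
  assume *: "z \<notin> S \<or> z' \<notin> T"
  have "[:-1, 1:] * h z z' = 0"
    unfolding h
  proof (rule conv_eq_0)
    fix u assume "u \<in> A"
    show "g z u * (if u \<in> S \<and> z' = s u then \<kappa> u z' else 0) = 0"
    proof (cases "u \<in> S \<and> z' = s u \<and> (z, u) \<in> r")
      case True
      then have "z \<in> S" "z' \<in> T" using s(1) T_S_not_r r_sub[of z u] A_eq by blast+
      then show ?thesis using * by auto
    qed (use supp in auto)
  qed
  moreover have "[:-1, 1:] \<noteq> (0 :: 'c poly)" by simp
  ultimately show ?thesis by (metis mult_eq_0_iff)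
qed

lemma l_outside: "z \<notin> S \<or> z' \<notin> T \<Longrightarrow> l z z' = 0"
  unfolding l
  by (rule conv_eq_0) (metis h_outside \<gamma>_supp upper mult_zero_left mult_zero_right)

lemma \<kappa>_via_s:
  assumes "x \<in> S" "y \<in> T"
  shows "\<kappa> x y = \<kappa> x (s x) * \<kappa> (s x) y"
proof (cases "(x, y) \<in> r")
  case True
  then show ?thesis using \<kappa>_mult s s_least assms by blast
next
  case False
  then have "(s x, y) \<notin> r" using s(2)[OF assms(1)] r_trans by blast
  then show ?thesis using False supp by simp
qed

text \<open>D^rev is g times the block of \<kappa> with columns in T times \<gamma>^rev. Middle
  indices of g in T give D back, as \<kappa> \<gamma>^rev = \<gamma>. For u in S the factor
  \<open>\<kappa> u (s u)\<close> splits off, the rest collapses to \<open>\<gamma> (s u) y\<close>,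
  and the sum over these u is the correction (t - 1) l.\<close>

lemma D_rev:
  assumes "x \<in> S" "y \<in> T"
  shows "rv D x y = [:-1, 1:] * l x y + D x y"
proof -
  have "rv D x y = conv T (rv g) (rv \<gamma>) x y"
    unfolding D_def by (rule rv_conv) (use supp \<gamma>_supp deg_le' in auto)
  also have "\<dots> = conv T (conv A g \<kappa>) (rv \<gamma>) x y" by (simp add: g_rv)
  also have "\<dots> = conv A g (conv T \<kappa> (rv \<gamma>)) x y" by (simp add: conv_assoc)
  also have "\<dots> = conv S g (conv T \<kappa> (rv \<gamma>)) x y + conv T g (conv T \<kappa> (rv \<gamma>)) x y"
    by (rule conv_split)
  also have "conv T g (conv T \<kappa> (rv \<gamma>)) x y = D x y"
    unfolding D_def using conv_\<kappa>_rv_\<gamma> supp ST_A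
    by (intro conv_cong) (simp flip: conv_eq_conv_T)
  also have "conv S g (conv T \<kappa> (rv \<gamma>)) x y = conv S g (\<lambda>u y. \<kappa> u (s u) * \<gamma> (s u) y) x y"
  proof (rule conv_cong)
    fix u assume u: "u \<in> S"
    have "conv T \<kappa> (rv \<gamma>) u y = \<kappa> u (s u) * conv T \<kappa> (rv \<gamma>) (s u) y"
      using u by (simp add: conv_def \<kappa>_via_s sum_distrib_left mult.assoc)
    also have "conv T \<kappa> (rv \<gamma>) (s u) y = \<gamma> (s u) y"
      using conv_\<kappa>_rv_\<gamma> supp ST_A s u by (simp flip: conv_eq_conv_T)
    finally show "g x u * conv T \<kappa> (rv \<gamma>) u y = g x u * (\<kappa> u (s u) * \<gamma> (s u) y)" by simp
  qed
  \<comment> \<open>Here (t - 1) l = (t - 1) h \<gamma> = g \<kappa>' \<gamma>, where row u of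
    \<kappa>' is supported at the single column \<open>s u\<close>, and only for u in S.\<close>
  also have "\<dots> = [:-1, 1:] * l x y"
  proof -
    let ?\<kappa>' = "\<lambda>x y. if x \<in> S \<and> y = s x then \<kappa> x y else 0"
    have "[:-1, 1:] * l x y = conv A (\<lambda>z z'. [:-1, 1:] * h z z') \<gamma> x y"
      unfolding l conv_def by (simp only: sum_distrib_left mult.assoc)
    also have "\<dots> = conv A g (conv A ?\<kappa>' \<gamma>) x y"
      by (simp only: h conv_assoc)
    also have "\<dots> = conv S g (conv A ?\<kappa>' \<gamma>) x y + conv T g (conv A ?\<kappa>' \<gamma>) x y"
      by (rule conv_split)
    also have "conv T g (conv A ?\<kappa>' \<gamma>) x y = 0"
      using T_not_S by (simp add: conv_def)
    also have "conv S g (conv A ?\<kappa>' \<gamma>) x y = conv S g (\<lambda>u y. \<kappa> u (s u) * \<gamma> (s u) y) x y"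
    proof (rule conv_cong)
      fix u assume u: "u \<in> S"
      have "conv A ?\<kappa>' \<gamma> u y = (\<Sum>v\<in>A. if v = s u then \<kappa> u (s u) * \<gamma> (s u) y else 0)"
        unfolding conv_def using u by (intro sum.cong) auto
      then show "g x u * conv A ?\<kappa>' \<gamma> u y = g x u * (\<kappa> u (s u) * \<gamma> (s u) y)"
        using finite_A s u ST_A by simp
    qed
    finally show ?thesis by simp
  qed
  finally show ?thesis .
qed

text \<open>For 2i < k the index k - i exceeds the degree of D, so coefficient i of D^rev is zero
  and \<open>D_rev\<close> becomes 0 = l_(i-1) - l_i + D_i.\<close>

lemma D_coeff:
  assumes "x \<in> S" "y \<in> T" "(x, y) \<in> r"
  shows "coeff (D x y) i = (if 2 * i < k x y then
    (if i = 0 then coeff (l x y) 0 else coeff (l x y) i - coeff (l x y) (i - 1)) else 0)"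
proof (cases "2 * i < k x y")
  case True
  then have "coeff (rv D x y) i = 0"
    using D_degree[OF assms] by (auto simp: coeff_rev_poly intro!: coeff_eq_0)
  with True show ?thesis
    unfolding D_rev[OF assms(1,2)] by (cases i) (auto simp: coeff_pCons algebra_simps)
next
  case False
  then show ?thesis using D_degree[OF assms] by (auto intro: coeff_eq_0)
qed

text \<open>Z is g^rev f, and its middle index is split. On S, f is replaced by minus f times the
  twisted D; on T, g^rev is replaced by D^rev g^rev, the reversal of g = D g. Triangularity then
  completes the remaining block products g^rev f to entries of Z.\<close>

lemma Z_eq_D:
  assumes "x \<in> S" "y \<in> T"
  shows "conv A (conv A g \<kappa>) f x y =
    - conv S (conv A (conv A g \<kappa>) f) (sgn_twist c D) x y + conv T (rv D) (conv A (conv A g \<kappa>) f) x y"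
proof -
  have Z: "conv A (conv A g \<kappa>) f = conv A (rv g) f"
    by (simp add: g_rv)
  have "conv A (rv g) f x y = conv S (rv g) f x y + conv T (rv g) f x y"
    by (rule conv_split)
  also have "conv S (rv g) f x y = - conv S (rv g) (conv S f (sgn_twist c D)) x y"
    using assms by (simp add: conv_def[of S "rv g"] f_eq_D sum_negf)
  also have "conv S (rv g) (conv S f (sgn_twist c D)) x y = conv S (conv S (rv g) f) (sgn_twist c D) x y"
    by (simp add: conv_assoc)
  also have "\<dots> = conv S (conv A (rv g) f) (sgn_twist c D) x y"
    by (rule conv_cong) (simp add: conv_eq_conv_S supp)
  also have "conv T (rv g) f x y = conv T (conv T (rv D) (rv g)) f x y"
  proof (rule conv_cong)
    fix u assume u: "u \<in> T"
    have "rv g x u = rv (conv T D g) x u" using g_eq_D assms u by simp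
    also have "\<dots> = conv T (rv D) (rv g) x u"
      using supp D_outside deg_le' D_degree assms(1) 
      by (intro rv_conv) (auto intro: less_imp_le dest: D_degree[OF assms(1)])
    finally show "rv g x u * f u y = conv T (rv D) (rv g) x u * f u y" by simp
  qed
  also have "\<dots> = conv T (rv D) (conv T (rv g) f) x y" by (simp add: conv_assoc)
  also have "\<dots> = conv T (rv D) (conv A (rv g) f) x y"
    by (rule conv_cong) (simp add: conv_eq_conv_T supp)
  finally show ?thesis unfolding Z .
qed

text \<open>\<open>D\<close> without its irrelevant values off \<open>X/Y\<close>; by the next lemma this is \<open>\<Delta>l\<close>.\<close>

definition D0 :: "'z \<Rightarrow> 'z \<Rightarrow> 'c poly" where
  "D0 = (\<lambda>z z'. if z \<in> S \<and> z' \<in> T then D z z' else 0)"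

text \<open>No condition on S and T is visible because l vanishes off S x T. In this shape the
  coefficients can be compared with those of \<Delta>l at every pair.\<close>

lemma coeff_D0:
  "coeff (D0 z z') i = (if (z, z') \<in> r \<and> z \<noteq> z' \<and> 2 * i < k z z' then
    (if i = 0 then coeff (l z z') 0 else coeff (l z z') i - coeff (l z z') (i - 1)) else 0)"
proof (cases "z \<in> S \<and> z' \<in> T")
  case True
  then have "z \<noteq> z'" using T_not_S by blast
  with True show ?thesis
    by (cases "(z, z') \<in> r") (simp_all add: D0_def D_coeff D_outside)
next
  case False
  then have "l z z' = 0" "D0 z z' = 0" using l_outside by (auto simp: D0_def)
  then show ?thesis by simp
qed

section \<open>The block identities as identities of full matrices\<close>

lemma restrict_g_eq:
  "conv A D0 g z z' = (if z \<in> S \<and> z' \<in> T then g z z' else 0)"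
proof (cases "z \<in> S \<and> z' \<in> T")
  case True
  have "conv S D0 g z z' = 0" by (rule conv_eq_0) (use T_not_S in \<open>auto simp: D0_def\<close>)
  moreover have "conv T D0 g z z' = conv T D g z z'"
    using True by (intro conv_cong) (simp add: D0_def)
  ultimately show ?thesis using True g_eq_D by (simp add: conv_split)
next
  case False
  have "D0 z u * g u z' = 0" for u
  proof (cases "z \<in> S \<and> u \<in> T")
    case True
    then have "z' \<notin> T" using False by blast
    then have "(u, z') \<notin> r" using True upper by blast
    then show ?thesis by (simp add: supp)
  qed (auto simp: D0_def)
  then have "conv A D0 g z z' = 0" by (rule conv_eq_0)
  with False show ?thesis by auto
qed

text \<open>D0 forces the middle index into T, and an element above it is again in T, so cutting the
  right factor down to T removes nothing.\<close>

lemma conv_D0_restrict: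
  assumes "\<And>u z'. (u, z') \<notin> r \<Longrightarrow> p u z' = 0"
  shows "conv A D0 (\<lambda>z z'. if z \<in> T \<and> z' \<in> T then p z z' else 0) z z' = conv A D0 p z z'"
proof (rule conv_cong)
  fix u
  show "D0 z u * (if u \<in> T \<and> z' \<in> T then p u z' else 0) = D0 z u * p u z'"
    using upper assms by (auto simp: D0_def)
qed

text \<open>Dually, D0 forces the middle index into S, and an element of A below it cannot lie in
  T.\<close>

lemma conv_restrict_D0:
  assumes "\<And>u z'. (u, z') \<notin> r \<Longrightarrow> p u z' = 0"
  shows "conv A (\<lambda>z z'. if z \<in> S \<and> z' \<in> S then p z z' else 0) (sgn_twist c D0) z z' =
    conv A p (sgn_twist c D0) z z'"
proof (rule conv_cong)
  fix u assume u: "u \<in> A"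
  show "(if z \<in> S \<and> u \<in> S then p z u else 0) * sgn_twist c D0 u z' = p z u * sgn_twist c D0 u z'"
  proof (cases "u \<in> S \<and> z \<notin> S")
    case True
    then have "(z, u) \<notin> r" using r_sub[of z u] upper[of z u] A_eq T_not_S by blast
    then show ?thesis using assms by simp
  qed (auto simp: sgn_twist_def D0_def)
qed

lemma conv_sgn_twist_D0:
  assumes "z \<in> S" "z' \<in> T"
  shows "conv A p (sgn_twist c D0) z z' = conv S p (sgn_twist c D) z z'"
proof -
  have "conv T p (sgn_twist c D0) z z' = 0"
    by (rule conv_eq_0) (use T_not_S in \<open>auto simp: sgn_twist_def D0_def\<close>)
  moreover have "conv S p (sgn_twist c D0) z z' = conv S p (sgn_twist c D) z z'"
    using assms by (intro conv_cong) (simp add: sgn_twist_def D0_def)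
  ultimately show ?thesis by (simp add: conv_split)
qed

lemma conv_sgn_twist_D0_outside:
  assumes "\<not> (z \<in> S \<and> z' \<in> T)" "\<And>u z'. (u, z') \<notin> r \<Longrightarrow> p u z' = 0"
  shows "conv A p (sgn_twist c D0) z z' = 0"
proof (rule conv_eq_0)
  fix u assume "u \<in> A"
  show "p z u * sgn_twist c D0 u z' = 0"
  proof (cases "u \<in> S \<and> z' \<in> T")
    case True
    then have "(z, u) \<notin> r" using assms(1) r_sub[of z u] upper[of z u] A_eq T_not_S by blast
    then show ?thesis using assms(2) by simp
  qed (auto simp: sgn_twist_def D0_def)
qed

lemma restrict_f_eq:
  "- conv A f (sgn_twist c D0) z z' = (if z \<in> S \<and> z' \<in> T then f z z' else 0)"
  using f_eq_D[of z z'] supp by (simp add: conv_sgn_twist_D0 conv_sgn_twist_D0_outside)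

lemma restrict_Z_eq:
  fixes Z defines "Z \<equiv> conv A (conv A g \<kappa>) f"
  shows "- conv A (\<lambda>z z'. if z \<in> S \<and> z' \<in> S then Z z z' else 0) (sgn_twist c D0) z z' +
      conv A (rv D0) (\<lambda>z z'. if z \<in> T \<and> z' \<in> T then Z z z' else 0) z z' =
    (if z \<in> S \<and> z' \<in> T then Z z z' else 0)"
proof -
  have g\<kappa>_supp: "conv A g \<kappa> u v = 0" if "(u, v) \<notin> r" for u v
    using trans_r that supp by (intro conv_outside)
  have Z_supp: "Z u v = 0" if "(u, v) \<notin> r" for u v
    unfolding Z_def using trans_r that g\<kappa>_supp supp by (intro conv_outside)
  have ZX: "conv A (\<lambda>z z'. if z \<in> S \<and> z' \<in> S then Z z z' else 0) (sgn_twist c D0) z z' =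
      conv A Z (sgn_twist c D0) z z'"
    by (rule conv_restrict_D0) (rule Z_supp)
  show ?thesis
  proof (cases "z \<in> S \<and> z' \<in> T")
    case True
    have "conv S (rv D0) (\<lambda>z z'. if z \<in> T \<and> z' \<in> T then Z z z' else 0) z z' = 0"
      by (rule conv_eq_0) (use T_not_S in auto)
    moreover have "conv T (rv D0) (\<lambda>z z'. if z \<in> T \<and> z' \<in> T then Z z z' else 0) z z' =
        conv T (rv D) Z z z'"
      using True by (intro conv_cong) (simp add: D0_def)
    ultimately have "conv A (rv D0) (\<lambda>z z'. if z \<in> T \<and> z' \<in> T then Z z z' else 0) z z' =
        conv T (rv D) Z z z'"
      by (simp only: conv_split add_0)
    moreover have "Z z z' = - conv S Z (sgn_twist c D) z z' + conv T (rv D) Z z z'"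
      using True Z_eq_D[of z z'] unfolding Z_def by blast
    ultimately show ?thesis
      unfolding ZX using True conv_sgn_twist_D0[of z z' Z] by simp
  next
    case False
    have "conv A (rv D0) (\<lambda>z z'. if z \<in> T \<and> z' \<in> T then Z z z' else 0) z z' = 0"
      by (rule conv_eq_0) (use False in \<open>auto simp: D0_def\<close>)
    moreover have "conv A Z (sgn_twist c D0) z z' = 0"
      using False Z_supp by (rule conv_sgn_twist_D0_outside)
    ultimately show ?thesis unfolding ZX using False by auto
  qed
qed

end

section \<open>Evaluation of equivariant incidence functions\<close>

lemma coeff_ev [simp]: "coeff (ev w p) i = coeff p i w"
  by (simp add: ev_def coeff_map_poly)

lemma ev_0 [simp]: "ev w 0 = 0"
  by (rule poly_eqI) simp

lemma sum_fun_apply: "(\<Sum>i\<in>I. F i) x = (\<Sum>i\<in>I. F i x)"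
  by (induction I rule: infinite_finite_induct) auto

lemma ev_sum: "ev w (\<Sum>i\<in>I. p i) = (\<Sum>i\<in>I. ev w (p i))"
  by (rule poly_eqI) (simp add: coeff_sum sum_fun_apply)

lemma ev_add: "ev w (p + q) = ev w p + ev w q"
  by (rule poly_eqI) simp

lemma ev_uminus: "ev w (- p) = - ev w p"
  by (rule poly_eqI) simp

lemma ev_mult: "ev w (p * q) = ev w p * ev w q"
  by (rule poly_eqI) (simp add: coeff_mult sum_fun_apply)

lemma ev_smult: "ev w (Polynomial.smult a p) = Polynomial.smult (a w) (ev w p)"
  by (rule poly_eqI) simp

lemma ev_Res_poly: "ev w (Res_poly H p) = (if w \<in> H then ev w p else 0)"
proof -
  have "Res H 0 = 0" by (simp add: Res_def fun_eq_iff)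
  then show ?thesis by (intro poly_eqI) (simp add: coeff_map_poly Res_def)
qed

lemma ev_Ind_poly:
  "ev w (Ind_poly W K H p) = (if w \<in> K
     then Polynomial.smult (1 / of_nat (card H))
       (\<Sum>k | k \<in> K \<and> inv\<^bsub>W\<^esub> k \<otimes>\<^bsub>W\<^esub> w \<otimes>\<^bsub>W\<^esub> k \<in> H. ev (inv\<^bsub>W\<^esub> k \<otimes>\<^bsub>W\<^esub> w \<otimes>\<^bsub>W\<^esub> k) p)
     else 0)"
proof -
  have "Ind W K H 0 = 0" by (simp add: Ind_def fun_eq_iff)
  then show ?thesis by (intro poly_eqI) (simp add: coeff_map_poly coeff_sum Ind_def)
qed

lemma ev_rev_poly: "ev w (rev_poly n p) = rev_poly n (ev w p)"
  by (rule poly_eqI) (simp add: coeff_rev_poly)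

lemma degree_ev_le: "degree (ev w p) \<le> degree p"
  by (rule degree_le) (simp add: coeff_eq_0)

lemma rpoly_eqI: "(\<And>w. ev w p = ev w q) \<Longrightarrow> p = q"
  by (metis coeff_ev ext poly_eqI)

lemma inc_rev_eq: "inc_rev k p = (\<lambda>z z'. rev_poly (k z z') (p z z'))"
  by (simp add: inc_rev_def rev_poly_def)

lemma rep_ring_outside: "a \<in> rep_ring W H \<Longrightarrow> w \<notin> H \<Longrightarrow> a w = 0"
  by (auto simp: rep_ring_def character_def)

lemma mem_stab2: "w \<in> stab2 W \<phi> z z' \<longleftrightarrow> w \<in> carrier W \<and> \<phi> w z = z \<and> \<phi> w z' = z'"
  by (auto simp: stab2_def stabilizer_def)

lemma mem_stab3: "w \<in> stab3 W \<phi> z u z' \<longleftrightarrow> w \<in> carrier W \<and> \<phi> w z = z \<and> \<phi> w u = u \<and> \<phi> w z' = z'"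
  by (auto simp: stab3_def stabilizer_def)

text \<open>The conditions of \<open>inc_alg\<close> as seen by evaluations: membership in the
  representation ring is replaced by vanishing off the stabiliser. This form passes easily through
  products, restrictions, reversal, sign twists and \<Delta>.\<close>

definition equivariant ::
  "('w, 'm) monoid_scheme \<Rightarrow> ('w \<Rightarrow> 'z \<Rightarrow> 'z) \<Rightarrow> 'z rel \<Rightarrow> ('z, 'w) inc \<Rightarrow> bool" where
  "equivariant W \<phi> r p \<longleftrightarrow>
     (\<forall>z z'. (z, z') \<notin> r \<longrightarrow> p z z' = 0) \<and>
     (\<forall>z z' w. w \<notin> stab2 W \<phi> z z' \<longrightarrow> ev w (p z z') = 0) \<and>
     (\<forall>v\<in>carrier W. \<forall>w\<in>carrier W. \<forall>z z'. (z, z') \<in> r \<longrightarrow>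
        ev (v \<otimes>\<^bsub>W\<^esub> w \<otimes>\<^bsub>W\<^esub> inv\<^bsub>W\<^esub> v) (p (\<phi> v z) (\<phi> v z')) = ev w (p z z'))"

lemma equivariant_outside: "equivariant W \<phi> r p \<Longrightarrow> (z, z') \<notin> r \<Longrightarrow> p z z' = 0"
  and equivariant_not_stab: "equivariant W \<phi> r p \<Longrightarrow> w \<notin> stab2 W \<phi> z z' \<Longrightarrow> ev w (p z z') = 0"
  and equivariant_conj: "equivariant W \<phi> r p \<Longrightarrow> v \<in> carrier W \<Longrightarrow> w \<in> carrier W \<Longrightarrow> (z, z') \<in> r \<Longrightarrow>
    ev (v \<otimes>\<^bsub>W\<^esub> w \<otimes>\<^bsub>W\<^esub> inv\<^bsub>W\<^esub> v) (p (\<phi> v z) (\<phi> v z')) = ev w (p z z')"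
  unfolding equivariant_def by blast+

locale eulerian_poset_action =
  fixes W :: "('w, 'm) monoid_scheme" (structure) and P :: "'z set" and r :: "'z rel"
    and \<rho> :: "'z \<Rightarrow> int" and \<phi> :: "'w \<Rightarrow> 'z \<Rightarrow> 'z"
  assumes finite_W: "finite (carrier W)" and finite_P: "finite P" and po: "partial_order_on P r"
    and act: "eulerian_action W P r \<rho> \<phi>"

sublocale eulerian_poset_action \<subseteq> group_action W P \<phi>
  using act by (simp add: eulerian_action_def)

sublocale eulerian_poset_action \<subseteq> group W
  using group_hom by (rule group_hom.axioms)

context eulerian_poset_action
begin

abbreviation "fix_set w \<equiv> fixed_set P \<phi> w"
abbreviation "fix_order w \<equiv> fixed_order P r \<phi> w"

lemma r_sub: "(z, z') \<in> r \<Longrightarrow> z \<in> P \<and> z' \<in> P"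
  and r_trans: "(z, u) \<in> r \<Longrightarrow> (u, z') \<in> r \<Longrightarrow> (z, z') \<in> r"
  using po by (auto simp: partial_order_on_def preorder_on_def dest: transD)

lemma finite_fix_set: "finite (fix_set w)"
  using finite_P by (simp add: fixed_set_def)

lemma mem_fix_order: "(z, z') \<in> fix_order w \<longleftrightarrow> (z, z') \<in> r \<and> \<phi> w z = z \<and> \<phi> w z' = z'"
  using r_sub by (auto simp: fixed_order_def fixed_set_def)

lemma act_closed: "w \<in> carrier W \<Longrightarrow> z \<in> P \<Longrightarrow> \<phi> w z \<in> P"
  using element_image by blast

lemma act_one: "z \<in> P \<Longrightarrow> \<phi> \<one> z = z"
  using id_eq_one[THEN fun_cong, of z] by simp

lemma act_inv: "w \<in> carrier W \<Longrightarrow> z \<in> P \<Longrightarrow> \<phi> (inv w) (\<phi> w z) = z"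
    "w \<in> carrier W \<Longrightarrow> z \<in> P \<Longrightarrow> \<phi> w (\<phi> (inv w) z) = z"
  using orbit_sym_aux[of w z] orbit_sym_aux[of "inv w" z] by simp_all

lemma act_r: "w \<in> carrier W \<Longrightarrow> (z, z') \<in> r \<Longrightarrow> (\<phi> w z, \<phi> w z') \<in> r"
  using act by (auto simp: eulerian_action_def)

lemma act_r_iff:
  assumes "w \<in> carrier W" "z \<in> P" "z' \<in> P"
  shows "(\<phi> w z, \<phi> w z') \<in> r \<longleftrightarrow> (z, z') \<in> r"
  using act_r[of w z z'] act_r[of "inv w" "\<phi> w z" "\<phi> w z'"] assms by (auto simp: act_inv)

lemma act_eq_iff: "w \<in> carrier W \<Longrightarrow> z \<in> P \<Longrightarrow> z' \<in> P \<Longrightarrow> \<phi> w z = \<phi> w z' \<longleftrightarrow> z = z'"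
  by (rule inj_on_eq_iff[OF inj_prop])

lemma act_conj:
  assumes "v \<in> carrier W" "w \<in> carrier W" "z \<in> P"
  shows "\<phi> (v \<otimes> w \<otimes> inv v) (\<phi> v z) = \<phi> v (\<phi> w z)"
  using assms by (simp add: composition_rule act_closed act_inv)

lemma conj_fixes_iff:
  assumes "v \<in> carrier W" "w \<in> carrier W" "z \<in> P"
  shows "\<phi> (v \<otimes> w \<otimes> inv v) (\<phi> v z) = \<phi> v z \<longleftrightarrow> \<phi> w z = z"
  using assms by (simp add: act_conj act_eq_iff act_closed)

lemma conj_stab2_iff:
  assumes "v \<in> carrier W" "w \<in> carrier W" "(z, z') \<in> r"
  shows "v \<otimes> w \<otimes> inv v \<in> stab2 W \<phi> (\<phi> v z) (\<phi> v z') \<longleftrightarrow> w \<in> stab2 W \<phi> z z'"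
  using assms r_sub[of z z'] by (simp add: mem_stab2 conj_fixes_iff)

text \<open>For w off the stabiliser the conjugation law is automatic: conjugation by v carries the
  stabiliser of a pair onto that of the translated pair, so both evaluations vanish.\<close>

lemma equivariantI:
  assumes "\<And>z z'. (z, z') \<notin> r \<Longrightarrow> p z z' = 0"
    and "\<And>z z' w. (z, z') \<in> r \<Longrightarrow> w \<notin> stab2 W \<phi> z z' \<Longrightarrow> ev w (p z z') = 0"
    and "\<And>v w z z'. v \<in> carrier W \<Longrightarrow> w \<in> stab2 W \<phi> z z' \<Longrightarrow> (z, z') \<in> r \<Longrightarrow>
      ev (v \<otimes> w \<otimes> inv v) (p (\<phi> v z) (\<phi> v z')) = ev w (p z z')"
  shows "equivariant W \<phi> r p"
  unfolding equivariant_def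
proof (intro conjI allI impI ballI)
  show *: "ev w (p z z') = 0" if "w \<notin> stab2 W \<phi> z z'" for z z' w
    using assms(1,2) that by (cases "(z, z') \<in> r") auto
  show "ev (v \<otimes> w \<otimes> inv v) (p (\<phi> v z) (\<phi> v z')) = ev w (p z z')"
    if "v \<in> carrier W" "w \<in> carrier W" "(z, z') \<in> r" for v w z z'
  proof (cases "w \<in> stab2 W \<phi> z z'")
    case False
    then show ?thesis using * conj_stab2_iff[OF that] by simp
  qed (use assms(3) that in auto)
qed (use assms in auto)

lemma inc_alg_equivariant:
  assumes "p \<in> inc_alg W \<phi> r"
  shows "equivariant W \<phi> r p"
proof (rule equivariantI)
  show "ev w (p z z') = 0" if "(z, z') \<in> r" "w \<notin> stab2 W \<phi> z z'" for w z z'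
  proof (rule poly_eqI)
    fix i
    have "coeff (p z z') i \<in> rep_ring W (stab2 W \<phi> z z')" using that assms by (simp add: inc_alg_def)
    then show "coeff (ev w (p z z')) i = coeff 0 i" using that rep_ring_outside by simp
  qed
  show "ev (v \<otimes> w \<otimes> inv v) (p (\<phi> v z) (\<phi> v z')) = ev w (p z z')"
    if "v \<in> carrier W" "w \<in> stab2 W \<phi> z z'" "(z, z') \<in> r" for v w z z'
    using that assms by (intro poly_eqI) (simp add: inc_alg_def)
qed (use assms in \<open>auto simp: inc_alg_def\<close>)

text \<open>The way back from fixed posets to W: an element outside the carrier lies in no
  stabiliser, so evaluations at group elements determine everything.\<close>

lemma equivariant_eqI:
  assumes "equivariant W \<phi> r p" "equivariant W \<phi> r q"
    and "\<And>w z z'. w \<in> carrier W \<Longrightarrow> ev w (p z z') = ev w (q z z')"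
  shows "p = q"
proof (intro ext rpoly_eqI)
  fix z z' w
  show "ev w (p z z') = ev w (q z z')"
    using assms equivariant_not_stab[of W \<phi> r _ w z z'] by (cases "w \<in> carrier W") (auto simp: mem_stab2)
qed

text \<open>Induction from the stabiliser of \<open>u\<close> sums over the orbit of \<open>u\<close>; the weights in the product are
  such that all fixed points \<open>u\<close> of \<open>w\<close> end up with coefficient one.\<close>

lemma ev_inc_mult:
  assumes p: "equivariant W \<phi> r p" and q: "equivariant W \<phi> r q" and w: "w \<in> carrier W"
  shows "ev w (inc_mult W \<phi> r p q z z') =
    conv (fix_set w) (\<lambda>z z'. ev w (p z z')) (\<lambda>z z'. ev w (q z z')) z z'"
proof (cases "w \<in> stab2 W \<phi> z z'")
  case False
  have 0: "ev w (p z u) * ev w (q u z') = 0" for u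
    using False equivariant_not_stab[OF p, of w z u] equivariant_not_stab[OF q, of w u z']
    by (auto simp: mem_stab2)
  have "conv (fix_set w) (\<lambda>z z'. ev w (p z z')) (\<lambda>z z'. ev w (q z z')) z z' = 0"
    by (rule conv_eq_0) (simp only: 0)
  then show ?thesis using False
    by (simp add: inc_mult_def ev_sum ev_smult ev_Ind_poly)
next
  case True
  let ?K = "stab2 W \<phi> z z'" and ?H = "\<lambda>u. stab3 W \<phi> z u z'"
  let ?B = "{u. (z, u) \<in> r \<and> (u, z') \<in> r}"
  let ?c = "\<lambda>k. inv k \<otimes> w \<otimes> k"
  let ?F = "\<lambda>w u. ev w (p z u) * ev w (q u z')"
  have finB: "finite ?B" by (rule finite_subset[OF _ finite_P]) (use r_sub in auto)
  have finK: "finite ?K" by (rule finite_subset[OF _ finite_W]) (auto simp: mem_stab2)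
  have K0: "of_nat (card ?K) \<noteq> (0 :: complex)" using finK True by auto
  have term_eq: "ev w (Polynomial.smult (const_fun (of_nat (card (?H u)) / of_nat (card ?K)))
      (Ind_poly W ?K (?H u) (Res_poly (?H u) (p z u) * Res_poly (?H u) (q u z')))) =
    Polynomial.smult (1 / of_nat (card ?K)) (\<Sum>k\<in>?K. ?F (?c k) u)" if u: "u \<in> ?B" for u
  proof -
    have "\<one> \<in> ?H u" using r_sub[of z u] r_sub[of u z'] u by (simp add: mem_stab3 act_one)
    moreover have "finite (?H u)" by (rule finite_subset[OF _ finite_W]) (auto simp: mem_stab3)
    ultimately have H0: "of_nat (card (?H u)) \<noteq> (0 :: complex)" by auto
    have "(\<Sum>k | k \<in> ?K \<and> ?c k \<in> ?H u. ev (?c k) (Res_poly (?H u) (p z u) * Res_poly (?H u) (q u z'))) =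
        (\<Sum>k\<in>?K. ?F (?c k) u)"
    proof (rule sum.mono_neutral_cong_left[OF finK])
      show "\<forall>k\<in>?K - {k \<in> ?K. ?c k \<in> ?H u}. ?F (?c k) u = 0"
        using equivariant_not_stab[OF p, of _ z u] equivariant_not_stab[OF q, of _ u z']
        by (auto simp: mem_stab2 mem_stab3)
    qed (auto simp: ev_mult ev_Res_poly)
    then show ?thesis using H0 True by (simp add: ev_smult ev_Ind_poly const_fun_def)
  qed
  \<comment> \<open>Evaluating at the conjugate of w by k amounts to moving u to k u, and k permutes
    the interval. Each k thus contributes the same sum and the average disappears.\<close>
  have inner: "(\<Sum>u\<in>?B. ?F (?c k) u) = (\<Sum>u\<in>?B. ?F w u)" if k: "k \<in> ?K" for k
  proof -
    have kW: "k \<in> carrier W" "\<phi> k z = z" "\<phi> k z' = z'" using k by (auto simp: mem_stab2)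
    have "(\<Sum>u\<in>?B. ?F (?c k) u) = (\<Sum>u\<in>?B. ?F w (\<phi> k u))"
    proof (rule sum.cong)
      fix u assume u: "u \<in> ?B"
      have "k \<otimes> ?c k \<otimes> inv k = (k \<otimes> inv k) \<otimes> w \<otimes> (k \<otimes> inv k)"
        using kW w by (simp only: m_assoc m_closed inv_closed)
      also have "\<dots> = w" using kW w by simp
      finally have "k \<otimes> ?c k \<otimes> inv k = w" .
      then have "ev w (p z (\<phi> k u)) = ev (?c k) (p z u)" "ev w (q (\<phi> k u) z') = ev (?c k) (q u z')"
        using equivariant_conj[OF p kW(1), of "?c k" z u] equivariant_conj[OF q kW(1), of "?c k" u z'] kW w u
        by auto
      then show "?F (?c k) u = ?F w (\<phi> k u)" by simp
    qed simp
    also have "\<dots> = (\<Sum>u\<in>?B. ?F w u)"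
    proof (rule sum.reindex_bij_betw)
      have "\<phi> k u \<in> ?B" if "u \<in> ?B" for u
        using act_r[OF kW(1), of z u] act_r[OF kW(1), of u z'] kW that by simp
      moreover have "inj_on (\<phi> k) ?B"
        using inj_prop[OF kW(1)] by (rule inj_on_subset) (use r_sub in auto)
      ultimately show "bij_betw (\<phi> k) ?B ?B"
        using endo_inj_surj[OF finB, of "\<phi> k"] by (auto simp: bij_betw_def)
    qed
    finally show ?thesis .
  qed
  have "ev w (inc_mult W \<phi> r p q z z') =
      (\<Sum>u\<in>?B. Polynomial.smult (1 / of_nat (card ?K)) (\<Sum>k\<in>?K. ?F (?c k) u))"
    unfolding inc_mult_def ev_sum using term_eq by (intro sum.cong) auto
  also have "\<dots> = Polynomial.smult (1 / of_nat (card ?K)) (\<Sum>k\<in>?K. \<Sum>u\<in>?B. ?F (?c k) u)"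
    by (subst sum.swap) (intro poly_eqI, simp add: coeff_sum sum_distrib_left sum_divide_distrib)
  also have "\<dots> = Polynomial.smult (1 / of_nat (card ?K)) (of_nat (card ?K) * (\<Sum>u\<in>?B. ?F w u))"
    using inner by simp
  also have "\<dots> = (\<Sum>u\<in>?B. ?F w u)"
    using K0 by (simp add: of_nat_poly)
  \<comment> \<open>Interval points moved by w contribute zero, since w is not in their stabiliser;
    fixed points outside the interval contribute zero by support.\<close>
  also have "\<dots> = (\<Sum>u\<in>fix_set w. ?F w u)"
  proof (rule sum.mono_neutral_cong)
    fix u assume "u \<in> fix_set w - ?B"
    then have "(z, u) \<notin> r \<or> (u, z') \<notin> r" by auto
    then show "?F w u = 0" using equivariant_outside[OF p] equivariant_outside[OF q] by auto
  next
    fix u assume "u \<in> ?B - fix_set w"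
    then have "w \<notin> stab2 W \<phi> z u" using r_sub by (auto simp: mem_stab2 fixed_set_def)
    then show "?F w u = 0" using equivariant_not_stab[OF p] by simp
  qed (use finB finite_fix_set in auto)
  finally show ?thesis by (simp add: conv_def)
qed

text \<open>After evaluation, conjugation invariance is a change of summation variable: v maps the
  fixed points of w bijectively onto those of its conjugate by v.\<close>

lemma equivariant_mult:
  assumes p: "equivariant W \<phi> r p" and q: "equivariant W \<phi> r q"
  shows "equivariant W \<phi> r (inc_mult W \<phi> r p q)"
proof (rule equivariantI)
  fix z z' assume "(z, z') \<notin> r"
  then have "{u. (z, u) \<in> r \<and> (u, z') \<in> r} = {}" using r_trans by blast
  then show "inc_mult W \<phi> r p q z z' = 0" unfolding inc_mult_def by (simp only: sum.empty)
next
  fix z z' w assume "w \<notin> stab2 W \<phi> z z'"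
  then show "ev w (inc_mult W \<phi> r p q z z') = 0"
    by (simp add: inc_mult_def ev_sum ev_smult ev_Ind_poly)
next
  fix v w z z' assume v: "v \<in> carrier W" and w: "w \<in> stab2 W \<phi> z z'" and zz: "(z, z') \<in> r"
  have wW: "w \<in> carrier W" using w by (simp add: mem_stab2)
  let ?w = "v \<otimes> w \<otimes> inv v"
  have bij: "bij_betw (\<phi> v) (fix_set w) (fix_set ?w)"
  proof (rule bij_betw_byWitness[where f' = "\<phi> (inv v)"])
    show "\<phi> v ` fix_set w \<subseteq> fix_set ?w"
      using v wW by (auto simp: fixed_set_def act_closed conj_fixes_iff)
    show "\<phi> (inv v) ` fix_set ?w \<subseteq> fix_set w"
    proof clarify
      fix u assume "u \<in> fix_set ?w"
      then have "u \<in> P" "\<phi> ?w u = u" by (auto simp: fixed_set_def)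
      then show "\<phi> (inv v) u \<in> fix_set w"
        using v wW conj_fixes_iff[OF v wW, of "\<phi> (inv v) u"] by (simp add: fixed_set_def act_closed act_inv)
    qed
  qed (use v in \<open>auto simp: fixed_set_def act_inv\<close>)
  have conj: "ev ?w (p (\<phi> v z) (\<phi> v u)) = ev w (p z u)" if "equivariant W \<phi> r p" "z \<in> P" "u \<in> P" for p z u
    using equivariant_conj[OF that(1) v wW] equivariant_outside[OF that(1)] act_r_iff[OF v that(2,3)] 
    by (cases "(z, u) \<in> r") auto
  have "ev ?w (inc_mult W \<phi> r p q (\<phi> v z) (\<phi> v z')) =
      (\<Sum>u\<in>fix_set w. ev ?w (p (\<phi> v z) (\<phi> v u)) * ev ?w (q (\<phi> v u) (\<phi> v z')))"
    using v wW by (simp add: ev_inc_mult[OF p q] conv_def sum.reindex_bij_betw[OF bij, symmetric])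
  also have "\<dots> = (\<Sum>u\<in>fix_set w. ev w (p z u) * ev w (q u z'))"
    using r_sub[OF zz] by (intro sum.cong) (auto simp: conj p q fixed_set_def)
  finally show "ev ?w (inc_mult W \<phi> r p q (\<phi> v z) (\<phi> v z')) = ev w (inc_mult W \<phi> r p q z z')"
    by (simp add: ev_inc_mult[OF p q wW] conv_def)
qed

lemma equivariant_uminus:
  assumes "equivariant W \<phi> r p"
  shows "equivariant W \<phi> r (- p)"
  using assms by (simp add: equivariant_def ev_uminus)

lemma equivariant_add:
  assumes "equivariant W \<phi> r p" "equivariant W \<phi> r q"
  shows "equivariant W \<phi> r (p + q)"
  using assms by (simp add: equivariant_def ev_add)

lemma equivariant_restrict:
  assumes "equivariant W \<phi> r p"
    and "\<And>v z z'. v \<in> carrier W \<Longrightarrow> (z, z') \<in> r \<Longrightarrow> Q (\<phi> v z) (\<phi> v z') = Q z z'"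
  shows "equivariant W \<phi> r (\<lambda>z z'. if Q z z' then p z z' else 0)"
proof (rule equivariantI)
  show "ev (v \<otimes> w \<otimes> inv v) (if Q (\<phi> v z) (\<phi> v z') then p (\<phi> v z) (\<phi> v z') else 0) =
      ev w (if Q z z' then p z z' else 0)"
    if "v \<in> carrier W" "w \<in> stab2 W \<phi> z z'" "(z, z') \<in> r" for v w z z'
  proof -
    have "w \<in> carrier W" using that by (simp add: mem_stab2)
    then show ?thesis using that assms(2) equivariant_conj[OF assms(1)] by simp
  qed
qed (simp_all add: equivariant_outside[OF assms(1)] equivariant_not_stab[OF assms(1)])

lemma equivariant_rev:
  assumes "equivariant W \<phi> r p" "weak_rank_function W \<phi> r k"
  shows "equivariant W \<phi> r (inc_rev k p)"
proof (rule equivariantI)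
  show "ev (v \<otimes> w \<otimes> inv v) (inc_rev k p (\<phi> v z) (\<phi> v z')) = ev w (inc_rev k p z z')"
    if "v \<in> carrier W" "w \<in> stab2 W \<phi> z z'" "(z, z') \<in> r" for v w z z'
  proof -
    have "w \<in> carrier W" using that by (simp add: mem_stab2)
    moreover have "k (\<phi> v z) (\<phi> v z') = k z z'"
      using assms(2) that by (simp add: weak_rank_function_def)
    ultimately show ?thesis
      using that equivariant_conj[OF assms(1)] by (simp add: inc_rev_eq ev_rev_poly)
  qed
qed (simp_all add: inc_rev_eq ev_rev_poly equivariant_outside[OF assms(1)] equivariant_not_stab[OF assms(1)])

lemma coeff_inc_Delta:
  assumes "weak_rank_function W \<phi> r k"
  shows "coeff (inc_Delta r k p z z') i = (if (z, z') \<in> r \<and> z \<noteq> z' \<and> 2 * i < k z z' then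
    (if i = 0 then coeff (p z z') 0 else coeff (p z z') i - coeff (p z z') (i - 1)) else 0)"
proof (cases "(z, z') \<in> r \<and> z \<noteq> z'")
  case True
  then have "k z z' > 0" using assms by (auto simp: weak_rank_function_def)
  \<comment> \<open>Positivity of k matters: with truncated subtraction, k = 0 would admit i = 0 on
    the right only.\<close>
  then have "2 * i < k z z' \<longleftrightarrow> i \<le> (k z z' - 1) div 2" by linarith
  then show ?thesis using True
    by (cases i) (auto simp: inc_Delta_def coeff_sum if_distrib cong: if_cong)
qed (auto simp: inc_Delta_def)

lemma equivariant_Delta:
  assumes p: "equivariant W \<phi> r p" and k: "weak_rank_function W \<phi> r k"
  shows "equivariant W \<phi> r (inc_Delta r k p)"
proof (rule equivariantI)
  fix z z' w assume "(z, z') \<in> r" "w \<notin> stab2 W \<phi> z z'"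
  then have "coeff (p z z') i w = 0" for i
    using equivariant_not_stab[OF p, of w z z'] coeff_ev[of w "p z z'" i] by simp
  then show "ev w (inc_Delta r k p z z') = 0"
    by (intro poly_eqI) (simp add: coeff_inc_Delta[OF k])
next
  fix v w z z' assume v: "v \<in> carrier W" and w: "w \<in> stab2 W \<phi> z z'" and zz: "(z, z') \<in> r"
  have "coeff (p (\<phi> v z) (\<phi> v z')) i (v \<otimes> w \<otimes> inv v) = coeff (p z z') i w" for i
    using arg_cong[OF equivariant_conj[OF p v _ zz, of w], of "\<lambda>p. coeff p i"] w
    by (simp add: mem_stab2)
  moreover have "k (\<phi> v z) (\<phi> v z') = k z z'" "(\<phi> v z, \<phi> v z') \<in> r" "\<phi> v z = \<phi> v z' \<longleftrightarrow> z = z'"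
    using k v zz r_sub[OF zz] act_r[OF v zz] act_eq_iff[OF v] by (auto simp: weak_rank_function_def)
  ultimately have "coeff (inc_Delta r k p (\<phi> v z) (\<phi> v z')) i (v \<otimes> w \<otimes> inv v) =
      coeff (inc_Delta r k p z z') i w" for i
    using zz by (simp add: coeff_inc_Delta[OF k])
  then show "ev (v \<otimes> w \<otimes> inv v) (inc_Delta r k p (\<phi> v z) (\<phi> v z')) = ev w (inc_Delta r k p z z')"
    by (intro poly_eqI) simp
next
  show "inc_Delta r k p z z' = 0" if "(z, z') \<notin> r" for z z'
    using that unfolding inc_Delta_def by simp
qed

section \<open>Ranks of the fixed posets and the signs of the twist\<close>

lemma fix_rank_function:
  assumes "w \<in> carrier W"
  shows "\<exists>\<tau>. lower_eulerian (fix_set w) (fix_order w) \<tau> \<and>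
    (\<forall>z z'. (z, z') \<in> fix_order w \<longrightarrow> rank_diff (fix_order w) z z' = \<tau> z' - \<tau> z)"
proof -
  obtain \<tau> where \<tau>: "lower_eulerian (fix_set w) (fix_order w) \<tau>"
    using act assms unfolding eulerian_action_def by blast
  then have "partial_order_on (fix_set w) (fix_order w)" "rank_function (fix_order w) \<tau>"
    by (simp_all add: lower_eulerian_def)
  from \<tau> rank_diff_eq[OF finite_fix_set this] show ?thesis by blast
qed

text \<open>A rank function on the fixed poset of the conjugate is pulled back along v. Covers
  correspond because v is an isomorphism of the two fixed posets, and the rank difference does not
  depend on the rank function chosen.\<close>

lemma rank_diff_conj:
  assumes v: "v \<in> carrier W" and w: "w \<in> carrier W" and zz: "(z, z') \<in> fix_order w"
  shows "rank_diff (fix_order (v \<otimes> w \<otimes> inv v)) (\<phi> v z) (\<phi> v z') = rank_diff (fix_order w) z z'"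
proof -
  let ?w = "v \<otimes> w \<otimes> inv v"
  have "?w \<in> carrier W" using v w by simp
  from fix_rank_function[OF this] obtain \<tau> where \<tau>: "lower_eulerian (fix_set ?w) (fix_order ?w) \<tau>"
    "\<And>z z'. (z, z') \<in> fix_order ?w \<Longrightarrow> rank_diff (fix_order ?w) z z' = \<tau> z' - \<tau> z"
    by blast
  have iff: "(\<phi> v a, \<phi> v b) \<in> fix_order ?w \<longleftrightarrow> (a, b) \<in> fix_order w" if "a \<in> P" "b \<in> P" for a b
    using that v w by (simp add: mem_fix_order conj_fixes_iff act_r_iff)
  have "rank_function (fix_order w) (\<lambda>z. \<tau> (\<phi> v z))"
    unfolding rank_function_def
  proof (intro allI impI)
    fix a b assume ab: "covers (fix_order w) a b"
    then have "a \<in> P" "b \<in> P" using r_sub by (auto simp: covers_def mem_fix_order)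
    moreover have "u = \<phi> v a \<or> u = \<phi> v b"
      if "(\<phi> v a, u) \<in> fix_order ?w" "(u, \<phi> v b) \<in> fix_order ?w" for u
    proof -
      have "u \<in> P" using that r_sub by (auto simp: mem_fix_order)
      then obtain u' where u': "u = \<phi> v u'" "u' \<in> P" using act_inv(2)[OF v, of u] act_closed[of "inv v" u] v by (metis inv_closed)
      then show ?thesis using that ab iff \<open>a \<in> P\<close> \<open>b \<in> P\<close> by (auto simp: covers_def)
    qed
    ultimately have "covers (fix_order ?w) (\<phi> v a) (\<phi> v b)"
      using ab v by (simp add: covers_def iff act_eq_iff)
    then show "\<tau> (\<phi> v b) = \<tau> (\<phi> v a) + 1"
      using \<tau>(1) by (simp add: lower_eulerian_def rank_function_def)
  qed
  moreover have "partial_order_on (fix_set w) (fix_order w)"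
    using fix_rank_function[OF w] by (auto simp: lower_eulerian_def)
  ultimately have "rank_diff (fix_order w) z z' = \<tau> (\<phi> v z') - \<tau> (\<phi> v z)"
    using rank_diff_eq[OF finite_fix_set] zz by blast
  moreover have "(\<phi> v z, \<phi> v z') \<in> fix_order ?w"
    using iff zz r_sub by (auto simp: mem_fix_order)
  ultimately show ?thesis using \<tau>(2) by simp
qed

lemma ev_inc_hat:
  "ev w (inc_hat P \<phi> r p z z') = Polynomial.smult ((-1) powi rank_diff (fix_order w) z z') (ev w (p z z'))"
proof -
  have "(\<lambda>w. (-1) powi rank_diff (fix_order w) z z' * (0 :: _ \<Rightarrow> complex) w) = 0" by (simp add: fun_eq_iff)
  then show ?thesis by (intro poly_eqI) (simp add: inc_hat_def coeff_map_poly)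
qed

lemma equivariant_hat:
  assumes p: "equivariant W \<phi> r p"
  shows "equivariant W \<phi> r (inc_hat P \<phi> r p)"
proof (rule equivariantI)
  show "inc_hat P \<phi> r p z z' = 0" if "(z, z') \<notin> r" for z z'
    using equivariant_outside[OF p that] by (simp add: inc_hat_def)
  show "ev w (inc_hat P \<phi> r p z z') = 0" if "w \<notin> stab2 W \<phi> z z'" for z z' w
    using equivariant_not_stab[OF p that] by (simp add: ev_inc_hat)
  show "ev (v \<otimes> w \<otimes> inv v) (inc_hat P \<phi> r p (\<phi> v z) (\<phi> v z')) = ev w (inc_hat P \<phi> r p z z')"
    if "v \<in> carrier W" "w \<in> stab2 W \<phi> z z'" "(z, z') \<in> r" for v w z z'
    using that equivariant_conj[OF p, of v w z z']
    by (simp add: ev_inc_hat mem_stab2 rank_diff_conj mem_fix_order)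
qed

text \<open>Since signs are their own inverses, (-1)^(\<tau>(z') - \<tau>(z)) is the product of the
  signs at z and z'. This presents the twist at w as a diagonal conjugation, with the same signs
  that make intervals Eulerian.\<close>

lemma hat_signs:
  assumes w: "w \<in> carrier W"
  obtains c :: "'z \<Rightarrow> complex" where "\<And>z. c z * c z = 1"
    "\<And>z z'. (z, z') \<in> fix_order w \<Longrightarrow> z \<noteq> z' \<Longrightarrow> (\<Sum>u | (z, u) \<in> fix_order w \<and> (u, z') \<in> fix_order w. c u) = 0"
    "\<And>p z z'. equivariant W \<phi> r p \<Longrightarrow>
      ev w (inc_hat P \<phi> r p z z') = sgn_twist c (\<lambda>z z'. ev w (p z z')) z z'"
proof -
  obtain \<tau> where \<tau>: "lower_eulerian (fix_set w) (fix_order w) \<tau>"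
    "\<And>z z'. (z, z') \<in> fix_order w \<Longrightarrow> rank_diff (fix_order w) z z' = \<tau> z' - \<tau> z"
    using fix_rank_function[OF w] by blast
  let ?c = "\<lambda>z. (-1 :: complex) powi \<tau> z"
  have 1: "?c z * ?c z = 1" for z by (rule power_int_minus_one_mult_self)
  have 2: "(\<Sum>u | (z, u) \<in> fix_order w \<and> (u, z') \<in> fix_order w. ?c u) = 0"
    if "(z, z') \<in> fix_order w" "z \<noteq> z'" for z z'
  proof -
    have "?c u = of_real ((-1) powi \<tau> u)" for u by (simp add: of_real_power_int)
    then have "(\<Sum>u | (z, u) \<in> fix_order w \<and> (u, z') \<in> fix_order w. ?c u) =
        of_real (\<Sum>u | (z, u) \<in> fix_order w \<and> (u, z') \<in> fix_order w. (-1) powi \<tau> u)" by simp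
    also have "(\<Sum>u | (z, u) \<in> fix_order w \<and> (u, z') \<in> fix_order w. (-1 :: real) powi \<tau> u) = 0"
      using \<tau>(1) that unfolding lower_eulerian_def by blast
    finally show ?thesis by simp
  qed
  have 3: "ev w (inc_hat P \<phi> r p z z') = sgn_twist ?c (\<lambda>z z'. ev w (p z z')) z z'"
    if p: "equivariant W \<phi> r p" for p z z'
  proof (cases "(z, z') \<in> fix_order w")
    case True
    have "(-1 :: complex) powi (\<tau> z' - \<tau> z) = ?c z * ?c z'"
      using 1[of z] by (simp add: power_int_diff field_simps)
    then show ?thesis using True by (simp add: ev_inc_hat sgn_twist_def \<tau>(2))
  next
    case False
    then have "ev w (p z z') = 0"
      using equivariant_outside[OF p, of z z'] equivariant_not_stab[OF p, of w z z']
      by (auto simp: mem_fix_order mem_stab2)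
    then show ?thesis by (simp add: ev_inc_hat sgn_twist_def)
  qed
  show ?thesis by (rule that[OF 1 2 3])
qed

end

section \<open>The poset of a subdivision\<close>

lemma mem_Gamma_order:
  "(Inl x, Inl x') \<in> Gamma_order X rX Y rY \<sigma> \<longleftrightarrow> (x, x') \<in> rX"
  "(Inr y, Inr y') \<in> Gamma_order X rX Y rY \<sigma> \<longleftrightarrow> (y, y') \<in> rY"
  "(Inl x, Inr y) \<in> Gamma_order X rX Y rY \<sigma> \<longleftrightarrow> x \<in> X \<and> y \<in> Y \<and> (\<sigma> x, y) \<in> rY"
  "(Inr y, Inl x) \<notin> Gamma_order X rX Y rY \<sigma>"
  by (auto simp: Gamma_order_def)

lemma partial_order_Gamma:
  assumes X: "partial_order_on X rX" and Y: "partial_order_on Y rY"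
    and mono: "\<And>x x'. (x, x') \<in> rX \<Longrightarrow> (\<sigma> x, \<sigma> x') \<in> rY"
  shows "partial_order_on (X <+> Y) (Gamma_order X rX Y rY \<sigma>)"
proof -
  have X': "refl_on X rX" "trans rX" "antisym rX" "rX \<subseteq> X \<times> X"
    and Y': "refl_on Y rY" "trans rY" "antisym rY" "rY \<subseteq> Y \<times> Y"
    using X Y by (auto simp: partial_order_on_def preorder_on_def)
  show ?thesis
    unfolding partial_order_on_def preorder_on_def
  proof (intro conjI)
    show "Gamma_order X rX Y rY \<sigma> \<subseteq> (X <+> Y) \<times> (X <+> Y)"
      using X'(4) Y'(4) by (auto simp: Gamma_order_def)
    show "refl_on (X <+> Y) (Gamma_order X rX Y rY \<sigma>)"
      using X'(1) Y'(1) by (auto simp: refl_on_def Gamma_order_def)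
    show "trans (Gamma_order X rX Y rY \<sigma>)"
    proof (rule transI)
      fix a b c assume "(a, b) \<in> Gamma_order X rX Y rY \<sigma>" "(b, c) \<in> Gamma_order X rX Y rY \<sigma>"
      then show "(a, c) \<in> Gamma_order X rX Y rY \<sigma>"
        using X'(4) Y'(4)
        by (cases a; cases b; cases c)
           (simp_all add: mem_Gamma_order, (blast intro: transD[OF X'(2)] transD[OF Y'(2)] mono)+)
    qed
    show "antisym (Gamma_order X rX Y rY \<sigma>)"
      using X'(3) Y'(3) by (auto simp: antisym_def Gamma_order_def)
  qed
qed

text \<open>In a finite poset a unique minimal element is least: among the elements below y, one
  with the smallest down-set is minimal, hence equal to \<open>zero_hat\<close>.\<close>

lemma zero_hat_le:
  assumes P: "lower_eulerian P r \<rho>" and "y \<in> P"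
  shows "(zero_hat P r, y) \<in> r"
proof -
  have fin: "finite P" and po: "partial_order_on P r" and ex1: "\<exists>!m. minimal_elt P r m"
    using P by (simp_all add: lower_eulerian_def)
  have r: "r \<subseteq> P \<times> P" "trans r" "antisym r" "refl_on P r"
    using po by (auto simp: partial_order_on_def preorder_on_def)
  define N where "N m = card {u. (u, m) \<in> r}" for m
  have "(y, y) \<in> r" using r(4) assms(2) by (auto simp: refl_on_def)
  then obtain m where m: "(m, y) \<in> r" and least: "\<And>u. (u, y) \<in> r \<Longrightarrow> N m \<le> N u"
    using ex_has_least_nat[of "\<lambda>m. (m, y) \<in> r" y N] by blast
  have "minimal_elt P r m"
    unfolding minimal_elt_def
  proof (intro conjI ballI impI)
    show "m \<in> P" using m r(1) by auto
    fix u assume u: "(u, m) \<in> r"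
    show "u = m"
    proof (rule ccontr)
      assume "u \<noteq> m"
      then have "(m, u) \<notin> r" using u r(3) by (auto dest: antisymD)
      moreover have "(m, m) \<in> r" using r(4) \<open>m \<in> P\<close> by (auto simp: refl_on_def)
      moreover have "{v. (v, u) \<in> r} \<subseteq> {v. (v, m) \<in> r}" using u r(2) by (auto dest: transD)
      ultimately have "{v. (v, u) \<in> r} \<subset> {v. (v, m) \<in> r}" by auto
      moreover have "finite {v. (v, m) \<in> r}" by (rule finite_subset[OF _ fin]) (use r(1) in auto)
      ultimately have "N u < N m" unfolding N_def by (rule psubset_card_mono[rotated])
      moreover have "N m \<le> N u" using least u m r(2) by (blast dest: transD)
      ultimately show False by simp
    qed
  qed
  then have "zero_hat P r = m" unfolding zero_hat_def using ex1 by (rule the1_equality[rotated])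
  with m show ?thesis by simp
qed

text \<open>\<open>\<sigma>\<close> as a map on \<open>\<Gamma>\<close>, extended by the identity on \<open>Y\<close>: \<open>up \<sigma> x\<close> is the least element of \<open>Y\<close>
  above \<open>x\<close>, which is why \<open>W\<close> commutes with it.\<close>

definition up :: "('a \<Rightarrow> 'b) \<Rightarrow> 'a + 'b \<Rightarrow> 'a + 'b" where
  "up \<sigma> = case_sum (Inr \<circ> \<sigma>) Inr"

text \<open>Brings the restrictions into the masked form of \<open>equivariant_restrict\<close>, so
  that their equivariance reduces to the invariance of the mask under W.\<close>

lemma restr_X_eq: "restr_X p = (\<lambda>z z'. if isl z \<and> isl z' then p z z' else 0)"
  and restr_Y_eq: "restr_Y p = (\<lambda>z z'. if \<not> isl z \<and> \<not> isl z' then p z z' else 0)"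
  and restr_XY_eq: "restr_XY p = (\<lambda>z z'. if isl z \<and> \<not> isl z' then p z z' else 0)"
  and restr_XY_interior_eq:
    "restr_XY_interior \<sigma> p = (\<lambda>z z'. if isl z \<and> z' = up \<sigma> z then p z z' else 0)"
  by (auto simp: restr_X_def restr_Y_def restr_XY_def restr_XY_interior_def up_def fun_eq_iff
      split: sum.split)

locale equivariant_subdivision =
  fixes X :: "'a set" and rX :: "'a rel" and \<rho>X :: "'a \<Rightarrow> int"
    and Y :: "'b set" and rY :: "'b rel" and \<rho>Y :: "'b \<Rightarrow> int"
    and \<sigma> :: "'a \<Rightarrow> 'b"
    and W :: "('w, 'm) monoid_scheme" and \<phi> :: "'w \<Rightarrow> 'a + 'b \<Rightarrow> 'a + 'b"
    and r :: "('a + 'b) rel" and k :: "'a + 'b \<Rightarrow> 'a + 'b \<Rightarrow> nat"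
    and \<kappa> f g g_inv h l :: "('a + 'b, 'w) inc"
  assumes X: "lower_eulerian X rX \<rho>X" and Y: "lower_eulerian Y rY \<rho>Y"
    and \<sigma>: "strong_formal_subdivision X rX \<rho>X Y rY \<rho>Y \<sigma>"
    and r: "r = Gamma_order X rX Y rY \<sigma>"
    and finite_carrier: "finite (carrier W)"
    and action: "eulerian_action W (X <+> Y) r (Gamma_rank \<rho>X \<rho>Y) \<phi>"
    and fix_zero: "w \<in> carrier W \<Longrightarrow> \<phi> w (Inr (zero_hat Y rY)) = Inr (zero_hat Y rY)"
    and k: "weak_rank_function W \<phi> r k"
    and \<kappa>: "\<kappa> \<in> inc_alg_deg W \<phi> r k \<inter> inc_unipotent W \<phi> r"
      "multiplicative W (X <+> Y) \<phi> r \<kappa>"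
    and f: "f \<in> inc_alg_half W \<phi> r k \<inter> inc_unipotent W \<phi> r" "inc_rev k f = inc_mult W \<phi> r \<kappa> f"
    and g: "g \<in> inc_alg_half W \<phi> r k \<inter> inc_unipotent W \<phi> r" "inc_rev k g = inc_mult W \<phi> r g \<kappa>"
    and h: "h \<in> inc_alg_deg W \<phi> r k"
      "(\<lambda>z z'. [:-1, 1:] * h z z') = inc_mult W \<phi> r g (restr_XY_interior \<sigma> \<kappa>)"
    and l: "inc_inverse W \<phi> r g g_inv" "l = inc_mult W \<phi> r h g_inv"

sublocale equivariant_subdivision \<subseteq> eulerian_poset_action W "X <+> Y" r "Gamma_rank \<rho>X \<rho>Y" \<phi>
proof
  show "finite (X <+> Y)" "partial_order_on (X <+> Y) r"
    using X Y \<sigma> partial_order_Gamma[of X rX Y rY \<sigma>]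
    by (auto simp: lower_eulerian_def strong_formal_subdivision_def r)
qed (fact finite_carrier action)+

context equivariant_subdivision
begin

section \<open>Compatibility of the action with X, Y and \<sigma>\<close>

lemma \<sigma>_in: "x \<in> X \<Longrightarrow> \<sigma> x \<in> Y"
  using \<sigma> by (auto simp: strong_formal_subdivision_def)

lemma r_refl: "z \<in> X <+> Y \<Longrightarrow> (z, z) \<in> r" and r_antisym: "(z, z') \<in> r \<Longrightarrow> (z', z) \<in> r \<Longrightarrow> z = z'"
  using po by (auto simp: partial_order_on_def preorder_on_def refl_on_def dest: antisymD)

lemma r_upper: "(z, z') \<in> r \<Longrightarrow> \<not> isl z \<Longrightarrow> \<not> isl z'"
  by (auto simp: r Gamma_order_def)

text \<open>Describes Y through the order and one point fixed by W; this is why the action cannot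
  mix X and Y.\<close>

lemma Y_iff: "(Inr (zero_hat Y rY), z) \<in> r \<longleftrightarrow> z \<in> X <+> Y \<and> \<not> isl z"
proof
  show "(Inr (zero_hat Y rY), z) \<in> r \<Longrightarrow> z \<in> X <+> Y \<and> \<not> isl z"
    using r_upper r_sub by fastforce
qed (use zero_hat_le[OF Y] in \<open>auto simp: r Gamma_order_def\<close>)

lemma isl_act: "v \<in> carrier W \<Longrightarrow> z \<in> X <+> Y \<Longrightarrow> isl (\<phi> v z) = isl z"
proof -
  assume v: "v \<in> carrier W" and z: "z \<in> X <+> Y"
  have "zero_hat Y rY \<in> Y"
    using Y theI'[of "minimal_elt Y rY"] by (auto simp: lower_eulerian_def zero_hat_def minimal_elt_def)
  then have "Inr (zero_hat Y rY) \<in> X <+> Y" by auto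
  then show ?thesis
    using Y_iff[of z] Y_iff[of "\<phi> v z"] act_r_iff[OF v _ z, of "Inr (zero_hat Y rY)"] fix_zero[OF v]
      act_closed[OF v z] z by auto
qed

lemma up_props:
  assumes "z \<in> X <+> Y" "isl z"
  shows "up \<sigma> z \<in> X <+> Y" "\<not> isl (up \<sigma> z)" "(z, up \<sigma> z) \<in> r"
    and "(z, y) \<in> r \<Longrightarrow> \<not> isl y \<Longrightarrow> (up \<sigma> z, y) \<in> r"
proof -
  obtain x where x: "z = Inl x" "x \<in> X" using assms by (auto simp: isl_def)
  have "(\<sigma> x, \<sigma> x) \<in> rY"
    using Y \<sigma>_in[OF x(2)] by (auto simp: lower_eulerian_def partial_order_on_def preorder_on_def refl_on_def)
  then show "up \<sigma> z \<in> X <+> Y" "\<not> isl (up \<sigma> z)" "(z, up \<sigma> z) \<in> r"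
    using x \<sigma>_in[OF x(2)] by (auto simp: up_def r Gamma_order_def)
  show "(z, y) \<in> r \<Longrightarrow> \<not> isl y \<Longrightarrow> (up \<sigma> z, y) \<in> r"
    using x by (auto simp: up_def r Gamma_order_def)
qed

text \<open>Two inequalities from leastness: v moves \<open>up \<sigma> z\<close> to an element of Y
  above v z, and the inverse of v moves \<open>up \<sigma> (\<phi> v z)\<close> to an element of Y
  above z.\<close>

lemma up_act:
  assumes v: "v \<in> carrier W" and z: "z \<in> X <+> Y" "isl z"
  shows "\<phi> v (up \<sigma> z) = up \<sigma> (\<phi> v z)"
proof (rule r_antisym)
  have vz: "\<phi> v z \<in> X <+> Y" "isl (\<phi> v z)"
    using act_closed isl_act v z by simp_all
  note u = up_props[OF z] and u' = up_props[OF vz]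
  show "(up \<sigma> (\<phi> v z), \<phi> v (up \<sigma> z)) \<in> r"
    using u'(4) act_r[OF v u(3)] isl_act[OF v u(1)] u(2) by blast
  let ?y = "\<phi> (inv\<^bsub>W\<^esub> v) (up \<sigma> (\<phi> v z))"
  have "(z, ?y) \<in> r" using act_r[OF inv_closed[OF v] u'(3)] by (simp add: act_inv v z)
  moreover have "\<not> isl ?y" using isl_act[OF inv_closed[OF v] u'(1)] u'(2) by simp
  ultimately have "(up \<sigma> z, ?y) \<in> r" by (rule u(4))
  from act_r[OF v this] show "(\<phi> v (up \<sigma> z), up \<sigma> (\<phi> v z)) \<in> r"
    by (simp add: act_inv v u'(1))
qed

lemma equivariants:
  "equivariant W \<phi> r \<kappa>" "equivariant W \<phi> r f" "equivariant W \<phi> r g" "equivariant W \<phi> r h"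
  "equivariant W \<phi> r g_inv" "equivariant W \<phi> r l"
proof -
  show *: "equivariant W \<phi> r \<kappa>" "equivariant W \<phi> r f" "equivariant W \<phi> r g" "equivariant W \<phi> r h"
      "equivariant W \<phi> r g_inv"
    using \<kappa>(1) f(1) g(1) h(1) l(1)
    by (auto simp: inc_alg_half_def inc_alg_deg_def inc_inverse_def intro: inc_alg_equivariant)
  show "equivariant W \<phi> r l"
    unfolding l(2) by (intro equivariant_mult *)
qed

lemma equivariant_restr:
  assumes "equivariant W \<phi> r p"
  shows "equivariant W \<phi> r (restr_X p)" "equivariant W \<phi> r (restr_Y p)"
    "equivariant W \<phi> r (restr_XY p)" "equivariant W \<phi> r (restr_XY_interior \<sigma> p)"
proof -
  have *: "isl (\<phi> v z) = isl z" "isl (\<phi> v z') = isl z'" if "v \<in> carrier W" "(z, z') \<in> r" for v z z'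
    using that isl_act r_sub[of z z'] by auto
  show "equivariant W \<phi> r (restr_X p)" "equivariant W \<phi> r (restr_Y p)" "equivariant W \<phi> r (restr_XY p)"
    unfolding restr_X_eq restr_Y_eq restr_XY_eq
    by (intro equivariant_restrict[OF assms]; simp add: *)+
  have "(isl (\<phi> v z) \<and> \<phi> v z' = up \<sigma> (\<phi> v z)) = (isl z \<and> z' = up \<sigma> z)"
    if "v \<in> carrier W" "(z, z') \<in> r" for v z z'
    using that r_sub[of z z'] up_props(1)[of z] 
    by (cases "isl z") (auto simp: * up_act[symmetric] act_eq_iff)
  then show "equivariant W \<phi> r (restr_XY_interior \<sigma> p)"
    unfolding restr_XY_interior_eq by (intro equivariant_restrict[OF assms])
qed

section \<open>Evaluation of the given data at one group element\<close>

abbreviation E :: "'w \<Rightarrow> ('a + 'b, 'w) inc \<Rightarrow> 'a + 'b \<Rightarrow> 'a + 'b \<Rightarrow> complex poly" where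
  "E w p \<equiv> \<lambda>z z'. ev w (p z z')"

lemma E_outside:
  assumes "equivariant W \<phi> r p" "(z, z') \<notin> fix_order w"
  shows "ev w (p z z') = 0"
  using assms equivariant_outside[OF assms(1), of z z'] equivariant_not_stab[OF assms(1), of w z z']
  by (auto simp: mem_fix_order mem_stab2)

lemma E_diag:
  assumes "p \<in> inc_unipotent W \<phi> r" "w \<in> carrier W" "z \<in> fix_set w"
  shows "ev w (p z z) = 1"
proof -
  have "(z, z) \<in> r" "\<phi> w z = z" using assms(3) r_refl by (auto simp: fixed_set_def)
  then have "p z z = [:indicator (stabilizer W \<phi> z):]" "w \<in> stabilizer W \<phi> z"
    using assms(1,2) by (auto simp: inc_unipotent_def stabilizer_def)
  then show ?thesis by (intro poly_eqI) (simp add: coeff_pCons split: nat.split)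
qed

lemma E_half:
  assumes "p \<in> inc_alg_half W \<phi> r k" "(z, z') \<in> fix_order w" "z \<noteq> z'"
  shows "2 * degree (ev w (p z z')) < k z z'"
proof -
  have "real (degree (p z z')) < real (k z z') / 2"
    using assms by (auto simp: inc_alg_half_def mem_fix_order)
  then show ?thesis using degree_ev_le[of w "p z z'"] by linarith
qed

text \<open>Connects the equivariant data with the abstract kernel: \<open>ev_inc_mult\<close> turns
  each defining equation into its matrix form, and \<open>up_act\<close> keeps
  \<open>up \<sigma>\<close> inside the fixed points. The same c serves for the Eulerian sums and
  for \<open>inc_hat\<close>.\<close>

lemma local_kernel:
  assumes w: "w \<in> carrier W"
  obtains c where "subdivided_kernel (fix_set w) (fix_order w) k c (E w \<kappa>) (E w f) (E w g)
      {z \<in> fix_set w. isl z} {z \<in> fix_set w. \<not> isl z} (up \<sigma>) (E w h) (E w l) (E w g_inv)"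
    "\<And>p z z'. equivariant W \<phi> r p \<Longrightarrow>
      ev w (inc_hat (X <+> Y) \<phi> r p z z') = sgn_twist c (E w p) z z'"
proof -
  obtain c :: "'a + 'b \<Rightarrow> complex" where c: "\<And>z. c z * c z = 1"
    "\<And>z z'. (z, z') \<in> fix_order w \<Longrightarrow> z \<noteq> z' \<Longrightarrow> (\<Sum>u | (z, u) \<in> fix_order w \<and> (u, z') \<in> fix_order w. c u) = 0"
    "\<And>p z z'. equivariant W \<phi> r p \<Longrightarrow>
      ev w (inc_hat (X <+> Y) \<phi> r p z z') = sgn_twist c (\<lambda>z z'. ev w (p z z')) z z'"
    using hat_signs[OF w] by blast
  note ev_mult' = ev_inc_mult[OF _ _ w]
  have "subdivided_kernel (fix_set w) (fix_order w) k c (E w \<kappa>) (E w f) (E w g)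
      {z \<in> fix_set w. isl z} {z \<in> fix_set w. \<not> isl z} (up \<sigma>) (E w h) (E w l) (E w g_inv)"
  proof
    show "finite (fix_set w)" by (rule finite_fix_set)
    show "partial_order_on (fix_set w) (fix_order w)"
      using fix_rank_function[OF w] by (auto simp: lower_eulerian_def)
    show "k z z' = k z u + k u z'" if "(z, u) \<in> fix_order w" "(u, z') \<in> fix_order w" for z u z'
      using k that unfolding weak_rank_function_def mem_fix_order by blast
    show "c z * c z = 1" for z by (rule c)
    show "(\<Sum>u | (z, u) \<in> fix_order w \<and> (u, z') \<in> fix_order w. c u) = 0"
      if "(z, z') \<in> fix_order w" "z \<noteq> z'" for z z' using c(2) that .
    show "E w \<kappa> z z' = 0" "E w f z z' = 0" "E w g z z' = 0" if "(z, z') \<notin> fix_order w" for z z'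
      using that E_outside equivariants by blast+
    show "E w \<kappa> z z = 1" "E w f z z = 1" "E w g z z = 1" if "z \<in> fix_set w" for z
      using that E_diag w \<kappa>(1) f(1) g(1) by blast+
    show "E w \<kappa> z z' = E w \<kappa> z u * E w \<kappa> u z'" if "(z, u) \<in> fix_order w" "(u, z') \<in> fix_order w" for z u z'
      using \<kappa>(2) that w unfolding multiplicative_def by blast
    show "2 * degree (E w f z z') < k z z'" "2 * degree (E w g z z') < k z z'"
      if "(z, z') \<in> fix_order w" "z \<noteq> z'" for z z'
      using that E_half f(1) g(1) by blast+
    show "rev_poly (k z z') (E w f z z') = conv (fix_set w) (E w \<kappa>) (E w f) z z'" for z z'
      using f(2) ev_mult'[OF equivariants(1,2)] 
      by (simp add: ev_rev_poly[symmetric] inc_rev_eq fun_eq_iff)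
    show "rev_poly (k z z') (E w g z z') = conv (fix_set w) (E w g) (E w \<kappa>) z z'" for z z'
      using g(2) ev_mult'[OF equivariants(3,1)] 
      by (simp add: ev_rev_poly[symmetric] inc_rev_eq fun_eq_iff)
    show "fix_set w = {z \<in> fix_set w. isl z} \<union> {z \<in> fix_set w. \<not> isl z}" by auto
    show "{z \<in> fix_set w. isl z} \<inter> {z \<in> fix_set w. \<not> isl z} = {}" by auto
    show "z \<in> {z \<in> fix_set w. \<not> isl z}" if "(y, z) \<in> fix_order w" "y \<in> {z \<in> fix_set w. \<not> isl z}" for y z
      using that r_upper[of y z] r_sub[of y z] by (auto simp: mem_fix_order fixed_set_def)
    show "up \<sigma> x \<in> {z \<in> fix_set w. \<not> isl z}" "(x, up \<sigma> x) \<in> fix_order w"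
      if "x \<in> {z \<in> fix_set w. isl z}" for x
      using that up_props[of x] up_act[OF w, of x] by (auto simp: mem_fix_order fixed_set_def)
    show "(up \<sigma> x, y) \<in> fix_order w" 
      if "x \<in> {z \<in> fix_set w. isl z}" "y \<in> {z \<in> fix_set w. \<not> isl z}" "(x, y) \<in> fix_order w" for x y
      using that up_props[of x] up_act[OF w, of x] by (auto simp: mem_fix_order fixed_set_def)
    show "[:-1, 1:] * E w h z z' = conv (fix_set w) (E w g)
        (\<lambda>x y. if x \<in> {z \<in> fix_set w. isl z} \<and> y = up \<sigma> x then E w \<kappa> x y else 0) z z'" for z z'
    proof -
      have "[:-1, 1:] * E w h z z' = ev w ([:-1, 1:] * h z z')"
      proof -
        \<comment> \<open>On the left, 1 is the constant function on the whole type, not the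
          indicator of a subgroup, so its value is 1 at every w.\<close>
        have "ev w [:-1, 1:] = [:-1, 1:]"
          by (intro poly_eqI) (simp add: coeff_pCons split: nat.split)
        then show ?thesis by (simp only: ev_mult)
      qed
      also have "\<dots> = conv (fix_set w) (E w g) (E w (restr_XY_interior \<sigma> \<kappa>)) z z'"
        using fun_cong[OF fun_cong[OF h(2)], of z z']
          ev_mult'[OF equivariants(3) equivariant_restr(4)[OF equivariants(1)]] by simp
      finally show ?thesis
        by (simp add: conv_def restr_XY_interior_eq if_distrib cong: if_cong sum.cong)
    qed
    show "conv (fix_set w) (E w g_inv) (E w g) z z' = (if z = z' then 1 else 0)"
      if "z \<in> fix_set w" "z' \<in> fix_set w" for z z'
    proof -
      have "conv (fix_set w) (E w g_inv) (E w g) z z' = ev w (inc_one W \<phi> r z z')"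
        using l(1) ev_mult'[OF equivariants(5,3), of z z'] by (simp add: inc_inverse_def)
      also have "\<dots> = (if z = z' then 1 else 0)"
        using that w r_refl[of z]
        by (intro poly_eqI) (auto simp: inc_one_def fixed_set_def stabilizer_def coeff_pCons split: nat.split)
      finally show ?thesis .
    qed
    show "E w l z z' = conv (fix_set w) (E w h) (E w g_inv) z z'" for z z'
      unfolding l(2) by (rule ev_mult'[OF equivariants(4,5)])
    show "E w g_inv z z' = 0" if "z' \<notin> fix_set w" for z z'
    proof -
      have "(z, z') \<notin> fix_order w" using that r_sub[of z z'] by (auto simp: mem_fix_order fixed_set_def)
      then show ?thesis using E_outside equivariants by blast
    qed
  qed
  then show ?thesis using that c(3) by blast
qed

section \<open>Lifting the local identities to W\<close>

abbreviation \<Delta>l :: "('a + 'b, 'w) inc" where "\<Delta>l \<equiv> inc_Delta r k l"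
abbreviation \<Delta>l_hat :: "('a + 'b, 'w) inc" where "\<Delta>l_hat \<equiv> inc_Delta r k (inc_hat (X <+> Y) \<phi> r l)"

text \<open>Proved jointly because all the identities come from the same interpretation of the local
  kernel at w; \<open>equivariant_eqI\<close> then lifts each of them.\<close>

lemma restr_g: "restr_XY g = inc_mult W \<phi> r \<Delta>l g"
  and restr_Y_g: "inc_mult W \<phi> r \<Delta>l g = inc_mult W \<phi> r \<Delta>l (restr_Y g)"
  and restr_f: "restr_XY f = - inc_mult W \<phi> r f \<Delta>l_hat"
  and restr_X_f: "inc_mult W \<phi> r f \<Delta>l_hat = inc_mult W \<phi> r (restr_X f) \<Delta>l_hat"
  and restr_Z: "Z = inc_mult W \<phi> r (inc_mult W \<phi> r g \<kappa>) f \<Longrightarrow>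
    restr_XY Z = - inc_mult W \<phi> r (restr_X Z) \<Delta>l_hat + inc_mult W \<phi> r (inc_rev k \<Delta>l) (restr_Y Z)"
proof -
  note eq = equivariants equivariant_restr equivariant_mult equivariant_uminus equivariant_add
    equivariant_rev[OF _ k] equivariant_Delta[OF _ k] equivariant_hat
  note ev = ev_inc_mult eq
  have all: "ev w (restr_XY g z z') = ev w (inc_mult W \<phi> r \<Delta>l g z z') \<and>
      ev w (inc_mult W \<phi> r \<Delta>l g z z') = ev w (inc_mult W \<phi> r \<Delta>l (restr_Y g) z z') \<and>
      ev w (restr_XY f z z') = ev w ((- inc_mult W \<phi> r f \<Delta>l_hat) z z') \<and>
      ev w (inc_mult W \<phi> r f \<Delta>l_hat z z') = ev w (inc_mult W \<phi> r (restr_X f) \<Delta>l_hat z z') \<and>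
      (Z = inc_mult W \<phi> r (inc_mult W \<phi> r g \<kappa>) f \<longrightarrow>
        ev w (restr_XY Z z z') =
        ev w ((- inc_mult W \<phi> r (restr_X Z) \<Delta>l_hat + inc_mult W \<phi> r (inc_rev k \<Delta>l) (restr_Y Z)) z z'))"
    if w: "w \<in> carrier W" for w z z'
  proof -
    obtain c where
      "subdivided_kernel (fix_set w) (fix_order w) k c (E w \<kappa>) (E w f) (E w g)
        {z \<in> fix_set w. isl z} {z \<in> fix_set w. \<not> isl z} (up \<sigma>) (E w h) (E w l) (E w g_inv)"
      and hat: "\<And>p z z'. equivariant W \<phi> r p \<Longrightarrow>
        ev w (inc_hat (X <+> Y) \<phi> r p z z') = sgn_twist c (E w p) z z'"
      using local_kernel[OF w] by blast
    then interpret K: subdivided_kernel "fix_set w" "fix_order w" k c "E w \<kappa>" "E w f" "E w g"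
        "{z \<in> fix_set w. isl z}" "{z \<in> fix_set w. \<not> isl z}" "up \<sigma>" "E w h" "E w l" "E w g_inv" by blast
    have l0: "coeff (l z z') i w = 0" if "(z, z') \<notin> fix_order w" for z z' i
      using E_outside[OF equivariants(6) that] coeff_ev[of w "l z z'" i] by simp
    \<comment> \<open>\<open>inc_Delta\<close> tests comparability in r, D0 in the fixed order. The
      two differ only at pairs where l evaluates to zero at w.\<close>
    have \<Delta>: "E w \<Delta>l = K.D0"
    proof (intro ext poly_eqI)
      fix z z' i
      show "coeff (E w \<Delta>l z z') i = coeff (K.D0 z z') i"
        using l0[of z z'] by (auto simp: K.coeff_D0 coeff_inc_Delta[OF k] mem_fix_order)
    qed
    \<comment> \<open>\<Delta> is linear in the coefficients of a single entry and the sign depends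
      only on the pair, so twisting commutes with \<Delta>.\<close>
    have \<Delta>_hat: "E w \<Delta>l_hat = sgn_twist c K.D0"
    proof (intro ext poly_eqI)
      fix z z' i
      have "coeff (inc_hat (X <+> Y) \<phi> r l z z') i w = c z * c z' * coeff (l z z') i w" for i
        using arg_cong[OF hat[OF equivariants(6), of z z'], of "\<lambda>p. coeff p i"] by (simp add: sgn_twist_def)
      then show "coeff (E w \<Delta>l_hat z z') i = coeff (sgn_twist c K.D0 z z') i"
        using l0[of z z']
        by (auto simp: K.coeff_D0 coeff_inc_Delta[OF k] mem_fix_order sgn_twist_def right_diff_distrib)
    qed
    have \<Delta>_rev: "E w (inc_rev k \<Delta>l) = K.rv K.D0"
      using \<Delta> by (simp add: inc_rev_eq ev_rev_poly fun_eq_iff)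
    have off: "ev w (p z z') = 0" if "equivariant W \<phi> r p" "z \<notin> fix_set w \<or> z' \<notin> fix_set w" for p z z'
    proof (rule E_outside[OF that(1)])
      show "(z, z') \<notin> fix_order w" using K.r_sub that(2) by blast
    qed
    have X: "E w (restr_X p) = (\<lambda>z z'. if z \<in> {z \<in> fix_set w. isl z} \<and> z' \<in> {z \<in> fix_set w. isl z} then E w p z z' else 0)"
      and Y: "E w (restr_Y p) = (\<lambda>z z'. if z \<in> {z \<in> fix_set w. \<not> isl z} \<and> z' \<in> {z \<in> fix_set w. \<not> isl z} then E w p z z' else 0)"
      and XY: "ev w (restr_XY p z z') = (if z \<in> {z \<in> fix_set w. isl z} \<and> z' \<in> {z \<in> fix_set w. \<not> isl z} then E w p z z' else 0)"
      if "equivariant W \<phi> r p" for p z z'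
      using off[OF that] by (auto simp: restr_X_eq restr_Y_eq restr_XY_eq fun_eq_iff)
    have "ev w (restr_XY Z z z') =
        ev w ((- inc_mult W \<phi> r (restr_X Z) \<Delta>l_hat + inc_mult W \<phi> r (inc_rev k \<Delta>l) (restr_Y Z)) z z')"
      if Z: "Z = inc_mult W \<phi> r (inc_mult W \<phi> r g \<kappa>) f"
    proof -
      have eZ: "equivariant W \<phi> r Z" unfolding Z by (intro eq)
      have Zeq: "ev w (Z z z') = conv (fix_set w) (conv (fix_set w) (E w g) (E w \<kappa>)) (E w f) z z'" for z z'
        unfolding Z using w by (simp add: ev)
      have "ev w ((- inc_mult W \<phi> r (restr_X Z) \<Delta>l_hat + inc_mult W \<phi> r (inc_rev k \<Delta>l) (restr_Y Z)) z z') =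
          - conv (fix_set w) (E w (restr_X Z)) (E w \<Delta>l_hat) z z' +
          conv (fix_set w) (E w (inc_rev k \<Delta>l)) (E w (restr_Y Z)) z z'"
        using w eZ by (simp add: ev ev_add ev_uminus del: uminus_add_conv_diff)
      also have "\<dots> = E w (restr_XY Z) z z'"
        unfolding \<Delta>_hat \<Delta>_rev X[OF eZ] Y[OF eZ] XY[OF eZ] Zeq by (rule K.restrict_Z_eq)
      finally show ?thesis by simp
    qed
    moreover have "ev w (restr_XY g z z') = ev w (inc_mult W \<phi> r \<Delta>l g z z')"
      using XY[OF equivariants(3), of z z'] w K.restrict_g_eq[of z z'] by (simp add: ev \<Delta>)
    moreover have "ev w (inc_mult W \<phi> r \<Delta>l g z z') = ev w (inc_mult W \<phi> r \<Delta>l (restr_Y g) z z')"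
    proof -
      have "ev w (inc_mult W \<phi> r \<Delta>l (restr_Y g) z z') = conv (fix_set w) K.D0 (E w (restr_Y g)) z z'"
        using w by (simp add: ev \<Delta>)
      also have "\<dots> = conv (fix_set w) K.D0 (E w g) z z'"
        unfolding Y[OF equivariants(3)] by (rule K.conv_D0_restrict) (rule K.supp)
      finally show ?thesis using w by (simp add: ev \<Delta>)
    qed
    moreover have "ev w (restr_XY f z z') = ev w ((- inc_mult W \<phi> r f \<Delta>l_hat) z z')"
      using XY[OF equivariants(2), of z z'] w K.restrict_f_eq[of z z']
      by (simp add: ev \<Delta>_hat ev_uminus)
    moreover have "ev w (inc_mult W \<phi> r f \<Delta>l_hat z z') = ev w (inc_mult W \<phi> r (restr_X f) \<Delta>l_hat z z')"
    proof -
      have "ev w (inc_mult W \<phi> r (restr_X f) \<Delta>l_hat z z') =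
          conv (fix_set w) (E w (restr_X f)) (sgn_twist c K.D0) z z'"
        using w by (simp add: ev \<Delta>_hat)
      also have "\<dots> = conv (fix_set w) (E w f) (sgn_twist c K.D0) z z'"
        unfolding X[OF equivariants(2)] by (rule K.conv_restrict_D0) (rule K.supp)
      finally show ?thesis using w by (simp add: ev \<Delta>_hat)
    qed
    ultimately show ?thesis by blast
  qed
  show "restr_XY g = inc_mult W \<phi> r \<Delta>l g"
    by (rule equivariant_eqI) (use all in \<open>auto intro!: eq\<close>)
  show "inc_mult W \<phi> r \<Delta>l g = inc_mult W \<phi> r \<Delta>l (restr_Y g)"
    by (rule equivariant_eqI) (use all in \<open>auto intro!: eq\<close>)
  show "restr_XY f = - inc_mult W \<phi> r f \<Delta>l_hat"
    by (rule equivariant_eqI) (use all in \<open>auto intro!: eq simp del: fun_Compl_def\<close>)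
  show "inc_mult W \<phi> r f \<Delta>l_hat = inc_mult W \<phi> r (restr_X f) \<Delta>l_hat"
    by (rule equivariant_eqI) (use all in \<open>auto intro!: eq\<close>)
  show "restr_XY Z = - inc_mult W \<phi> r (restr_X Z) \<Delta>l_hat + inc_mult W \<phi> r (inc_rev k \<Delta>l) (restr_Y Z)"
    if Z: "Z = inc_mult W \<phi> r (inc_mult W \<phi> r g \<kappa>) f"
  proof (rule equivariant_eqI)
    have eZ: "equivariant W \<phi> r Z" unfolding Z by (intro eq)
    show "equivariant W \<phi> r (restr_XY Z)" by (intro eq eZ)
    show "equivariant W \<phi> r (- inc_mult W \<phi> r (restr_X Z) \<Delta>l_hat + inc_mult W \<phi> r (inc_rev k \<Delta>l) (restr_Y Z))"
      by (intro eq eZ)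
  qed (use all Z in blast)
qed

text \<open>The interval from x to y in \<Gamma> also contains elements of X, but there
  \<open>restr_Y g\<close> vanishes. The remaining middle elements are those of Y above
  \<sigma>(x).\<close>

lemma g_XY_expansion:
  assumes "x \<in> X" "y \<in> Y" "(\<sigma> x, y) \<in> rY"
  shows "g (Inl x) (Inr y) =
    (\<Sum>y' | (\<sigma> x, y') \<in> rY \<and> (y', y) \<in> rY.
      Polynomial.smult (const_fun (of_nat (card (stab3 W \<phi> (Inl x) (Inr y') (Inr y))) /
                        of_nat (card (stab2 W \<phi> (Inl x) (Inr y)))))
        (Ind_poly W (stab2 W \<phi> (Inl x) (Inr y)) (stab3 W \<phi> (Inl x) (Inr y') (Inr y))
          (Res_poly (stab3 W \<phi> (Inl x) (Inr y') (Inr y)) (\<Delta>l (Inl x) (Inr y')) *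
           Res_poly (stab3 W \<phi> (Inl x) (Inr y') (Inr y)) (restr_Y g (Inr y') (Inr y)))))"
    (is "_ = (\<Sum>y' | _. ?F (Inr y'))")
proof -
  have "g (Inl x) (Inr y) = restr_XY g (Inl x) (Inr y)" by (simp add: restr_XY_def)
  also have "\<dots> = (\<Sum>z | (Inl x, z) \<in> r \<and> (z, Inr y) \<in> r. ?F z)"
    using fun_cong[OF fun_cong[OF trans[OF restr_g restr_Y_g]], of "Inl x" "Inr y"]
    by (simp only: inc_mult_def)
  also have "\<dots> = (\<Sum>z\<in>Inr ` {y'. (\<sigma> x, y') \<in> rY \<and> (y', y) \<in> rY}. ?F z)"
  proof (rule sum.mono_neutral_right)
    show "finite {z. (Inl x, z) \<in> r \<and> (z, Inr y) \<in> r}"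
      by (rule finite_subset[OF _ finite_P]) (use r_sub in auto)
    have "rY \<subseteq> Y \<times> Y" using Y by (simp add: lower_eulerian_def partial_order_on_def preorder_on_def)
    then show "Inr ` {y'. (\<sigma> x, y') \<in> rY \<and> (y', y) \<in> rY} \<subseteq> {z. (Inl x, z) \<in> r \<and> (z, Inr y) \<in> r}"
      using assms by (auto simp: r Gamma_order_def)
    show "\<forall>z\<in>{z. (Inl x, z) \<in> r \<and> (z, Inr y) \<in> r} - Inr ` {y'. (\<sigma> x, y') \<in> rY \<and> (y', y) \<in> rY}. ?F z = 0"
    proof
      fix z assume "z \<in> {z. (Inl x, z) \<in> r \<and> (z, Inr y) \<in> r} - Inr ` {y'. (\<sigma> x, y') \<in> rY \<and> (y', y) \<in> rY}"
      then obtain x' where "z = Inl x'" by (auto simp: r Gamma_order_def)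
      then show "?F z = 0" by (simp add: restr_Y_def)
    qed
  qed
  also have "\<dots> = (\<Sum>y' | (\<sigma> x, y') \<in> rY \<and> (y', y) \<in> rY. ?F (Inr y'))"
    by (simp add: sum.reindex)
  finally show ?thesis .
qed

end

theorem theorem4p18:
  fixes X :: "'a set" and rX :: "'a rel" and \<rho>X :: "'a \<Rightarrow> int"
    and Y :: "'b set" and rY :: "'b rel" and \<rho>Y :: "'b \<Rightarrow> int"
    and \<sigma> :: "'a \<Rightarrow> 'b"
    and W :: "('w, 'm) monoid_scheme" and \<phi> :: "'w \<Rightarrow> 'a + 'b \<Rightarrow> 'a + 'b"
    and r :: "('a + 'b) rel" and k :: "'a + 'b \<Rightarrow> 'a + 'b \<Rightarrow> nat"
    and mult :: "('a + 'b, 'w) inc \<Rightarrow> ('a + 'b, 'w) inc \<Rightarrow> ('a + 'b, 'w) inc" (infixl "\<star>" 70)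
    and \<kappa> f g g_inv Z h l :: "('a + 'b, 'w) inc"
  assumes "lower_eulerian X rX \<rho>X" and "lower_eulerian Y rY \<rho>Y"
    and "strong_formal_subdivision X rX \<rho>X Y rY \<rho>Y \<sigma>"
    and r: "r = Gamma_order X rX Y rY \<sigma>"
    and "group W" and "finite (carrier W)"
    and "eulerian_action W (X <+> Y) r (Gamma_rank \<rho>X \<rho>Y) \<phi>"
    and "\<forall>w\<in>carrier W. \<phi> w (Inr (zero_hat Y rY)) = Inr (zero_hat Y rY)"
    and "weak_rank_function W \<phi> r k"
    and mult: "mult = inc_mult W \<phi> r"
    and "\<kappa> \<in> inc_alg_deg W \<phi> r k \<inter> inc_unipotent W \<phi> r"
    and "multiplicative W (X <+> Y) \<phi> r \<kappa>"
    and "rank_alternating (X <+> Y) \<phi> r k \<kappa>"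
    and f: "f \<in> inc_alg_half W \<phi> r k \<inter> inc_unipotent W \<phi> r" "inc_rev k f = \<kappa> \<star> f"
    and g: "g \<in> inc_alg_half W \<phi> r k \<inter> inc_unipotent W \<phi> r" "inc_rev k g = g \<star> \<kappa>"
    and Z: "Z = g \<star> \<kappa> \<star> f"
    and h: "h \<in> inc_alg_deg W \<phi> r k" "(\<lambda>z z'. [:-1, 1:] * h z z') = g \<star> restr_XY_interior \<sigma> \<kappa>"
    and l: "inc_inverse W \<phi> r g g_inv" "l = h \<star> g_inv"
  shows "restr_XY g = inc_Delta r k l \<star> g \<and>
     inc_Delta r k l \<star> g = inc_Delta r k l \<star> restr_Y g \<and>
     restr_XY f = - (f \<star> inc_Delta r k (inc_hat (X <+> Y) \<phi> r l)) \<and>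
     - (f \<star> inc_Delta r k (inc_hat (X <+> Y) \<phi> r l)) =
         - (restr_X f \<star> inc_Delta r k (inc_hat (X <+> Y) \<phi> r l)) \<and>
     restr_XY Z = - (restr_X Z \<star> inc_Delta r k (inc_hat (X <+> Y) \<phi> r l))
                      + inc_rev k (inc_Delta r k l) \<star> restr_Y Z \<and>
     (\<forall>x\<in>X. \<forall>y\<in>Y. (\<sigma> x, y) \<in> rY \<longrightarrow>
         g (Inl x) (Inr y) =
         (\<Sum>y' | (\<sigma> x, y') \<in> rY \<and> (y', y) \<in> rY.
            Polynomial.smult (const_fun (of_nat (card (stab3 W \<phi> (Inl x) (Inr y') (Inr y))) /
                              of_nat (card (stab2 W \<phi> (Inl x) (Inr y)))))
              (Ind_poly W (stab2 W \<phi> (Inl x) (Inr y)) (stab3 W \<phi> (Inl x) (Inr y') (Inr y))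
                (Res_poly (stab3 W \<phi> (Inl x) (Inr y') (Inr y)) (inc_Delta r k l (Inl x) (Inr y')) *
                 Res_poly (stab3 W \<phi> (Inl x) (Inr y') (Inr y)) (restr_Y g (Inr y') (Inr y))))))"
proof -
  interpret equivariant_subdivision X rX \<rho>X Y rY \<rho>Y \<sigma> W \<phi> r k \<kappa> f g g_inv h l
    using assms by unfold_locales (auto simp: mult)
  show ?thesis
    unfolding mult using restr_g restr_Y_g restr_f restr_X_f restr_Z[of Z] g_XY_expansion Z
    by (simp add: mult)
qed

end
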